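(* Any rotationally invariant zero mean curvature surface in $\mathbb{Q}^3_+$ (i.e. any rotational surface which is a spacelike immersed surface of zero mean curvature) is, up to homotheties and isometries of $\mathbb{Q}^3_+$, a piece of one of the following surfaces, where $w=u+iv$ and each surface is listed with its Weierstrass data $(G,\Omega)$: - an elliptic catenoid, for some $a\in\mathbb{R}$: $$X^{\mathrm E}(u,v)=\begin{pmatrix} e^{(a-2)v} & e^{2iu+av} \\ e^{-2iu+av} & e^{(a+2)v} \end{pmatrix},\qquad G=\tfrac{a-2}{a+2}e^{2iw},\quad \Omega=\tfrac{-i(a+2)^2}{8}e^{-2iw}\,\mathrm{d}w;$$ - a hyperbolic catenoid, for some $b\in\mathbb{R}$: $$X^{\mathrm H}(u,v)=\begin{pmatrix} e^{2u+bv} & e^{(b+2i)v} \\ e^{(b-2i)v} & e^{-2u+bv} \end{pmatrix},\qquad G=\tfrac{b+2i}{b-2i}e^{2w},\quad \Omega=\tfrac{(b-2i)^2}{8}e^{-2w}\,\mathrm{d}w;$$ - a parabolic catenoid, for some $c\in\mathbb{R}$: $$X^{\mathrm P}(u,v)=\begin{pmatrix} e^{cv}(u^2+v^2) & e^{cv}(u+iv) \\ e^{cv}(u-iv) & e^{cv} \end{pmatrix},\qquad G=w+\tfrac{2i}{c},\quad \Omega=\tfrac{c^2}{4}\,\mathrm{d}w.$$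
   Context: Lorentz space. $\mathbb{L}^4$ is $\mathbb{R}^4$ with $\langle (t_1,x_1,y_1,z_1),(t_2,x_2,y_2,z_2)\rangle=-t_1t_2+x_1x_2+y_1y_2+z_1z_2$, identified with the $2\times2$ Hermitian matrices $\mathrm{Herm}(2,\mathbb{C})$ via $(t,x,y,z)\sim\begin{pmatrix} t+z & x+iy \\ x-iy & t-z \end{pmatrix}$; then $\langle V,V\rangle=-\det V$. $F^\star$ is the conjugate transpose. The three-dimensional light cone is $\mathbb{Q}^3_+=\{X\in\mathrm{Herm}(2,\mathbb{C}):\langle X,X\rangle=0,\ \operatorname{tr}X>0\}$. Isometries of $\mathbb{Q}^3_+$ are restrictions of linear isometries of $\mathbb{L}^4$ preserving $\mathbb{Q}^3_+$; homotheties are the maps $X\mapsto rX$, $r>0$. Zero mean curvature surfaces. Let $X:D\to\mathbb{Q}^3_+$ be a spacelike immersion (induced metric Riemannian) in conformal coordinates $(u,v)$ with induced metric $\phi^2(\mathrm{d}u^2+\mathrm{d}v^2)$. Its Gauss map is the unique $n:D\to\mathbb{L}^4$ with $\langle n,n\rangle=\langle n,X_u\rangle=\langle n,X_v\rangle=0$, $\langle n,X\rangle=1$. The mean curvature is $H=-\tfrac12\phi^{-2}(\langle X_u,n_u\rangle+\langle X_v,n_v\rangle)$; $X$ is a zero mean curvature surface if $H\equiv0$. Weierstrass data. $X$ has Weierstrass data $(G,\Omega)$ ($G$ meromorphic, $\Omega$ a holomorphic $1$-form, $G^2\Omega$ holomorphic) if $X=F\begin{pmatrix} 1 & 0 \\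 0 & 0 \end{pmatrix}F^\star$ for some $F:D\to\mathrm{SL}(2,\mathbb{C})$ with $\mathrm{d}F\,F^{-1}=\begin{pmatrix} G & -G^2 \\ 1 & -G \end{pmatrix}\Omega$. When the displayed $G$ is not defined ($a=-2$ or $c=0$), the data are understood via the matrix $\begin{pmatrix} G\Omega & -G^2\Omega \\ \Omega & -G\Omega \end{pmatrix}$, whose entries are polynomial in the parameter. Rotational surfaces. Let $P^k$ denote a $k$-dimensional linear subspace of $\mathbb{L}^4$. Choose $P^2\subset P^3$ with $P^3\cap\mathbb{Q}^3_+\neq\varnothing$, and let $\mathrm{O}(P^2)$ be the set of orthogonal transformations of $\mathbb{L}^4$ (preserving $\mathbb{Q}^3_+$) that fix $P^2$ pointwise. For a regular curve $\gamma$ in $P^3\cap\mathbb{Q}^3_+$ that does not meet $P^2$, the orbit of $\gamma$ under $\mathrm{O}(P^2)$ is the rotational surface generated by $\gamma$. (It is called elliptic, parabolic or hyperbolic if the induced metric on $P^2$ is Lorentzian, degenerate or Riemannian, respectively.) "A piece of" a surface means that the image is contained in the image of that surface. *)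

theory Defs
  imports "HOL-Complex_Analysis.Complex_Analysis"
begin

section \<open>Lorentz space and Hermitian matrices\<close>

text \<open>The components \<open>1, 2, 3, 4\<close> of a vector are \<open>t, x, y, z\<close>.\<close>

type_synonym L4 = "real^4"

definition lorentz :: "L4 \<Rightarrow> L4 \<Rightarrow> real" where
  "lorentz v w = - (v$1 * w$1) + v$2 * w$2 + v$3 * w$3 + v$4 * w$4"

definition mat2 :: "complex \<Rightarrow> complex \<Rightarrow> complex \<Rightarrow> complex \<Rightarrow> complex^2^2" where
  "mat2 a b c d = vector [vector [a, b], vector [c, d]]"

definition ctranspose :: "complex^2^2 \<Rightarrow> complex^2^2" where
  "ctranspose A = (\<chi> i j. cnj (A $ j $ i))"

text \<open>The identification of \<open>\<real>\<^sup>4\<close> with the Hermitian matrices.\<close>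

definition herm :: "L4 \<Rightarrow> complex^2^2" where
  "herm v = mat2 (of_real (v$1 + v$4)) (Complex (v$2) (v$3))
                 (Complex (v$2) (- v$3)) (of_real (v$1 - v$4))"

lemma mat2_nth [simp]:
  "mat2 a b c d $ 1 $ 1 = a" "mat2 a b c d $ 1 $ 2 = b"
  "mat2 a b c d $ 2 $ 1 = c" "mat2 a b c d $ 2 $ 2 = d"
  by (simp_all add: mat2_def)

lemma mat2_eq_iff: "mat2 a b c d = mat2 a' b' c' d' \<longleftrightarrow> a = a' \<and> b = b' \<and> c = c' \<and> d = d'"
  by (metis mat2_nth)

lemma range_herm: "range herm = {A. ctranspose A = A}"
proof (rule set_eqI, rule iffI)
  fix A assume "A \<in> range herm"
  then show "A \<in> {A. ctranspose A = A}"
    by (auto simp: herm_def ctranspose_def vec_eq_iff forall_2 complex_eq_iff)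
next
  fix A :: "complex^2^2" assume "A \<in> {A. ctranspose A = A}"
  then have h: "cnj (A$1$1) = A$1$1" "cnj (A$2$2) = A$2$2" "cnj (A$1$2) = A$2$1"
    by (auto simp: ctranspose_def vec_eq_iff forall_2)
  define v :: L4 where "v = (\<chi> i. if i = 1 then (Re (A$1$1) + Re (A$2$2)) / 2
      else if i = 2 then Re (A$1$2) else if i = 3 then Im (A$1$2)
      else (Re (A$1$1) - Re (A$2$2)) / 2)"
  have "herm v = A"
    using h by (auto simp: herm_def v_def vec_eq_iff forall_2 complex_eq_iff field_simps)
  then show "A \<in> range herm" by auto
qed

lemma lorentz_eq_det: "of_real (lorentz v v) = - det (herm v)"
  by (simp add: lorentz_def herm_def det_2 complex_eq_iff algebra_simps)

definition light_cone :: "L4 set" where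
  "light_cone = {v. lorentz v v = 0 \<and> 0 < Re (trace (herm v))}"

definition cone_isometry :: "(L4 \<Rightarrow> L4) \<Rightarrow> bool" where
  "cone_isometry T \<longleftrightarrow>
     linear T \<and> (\<forall>v w. lorentz (T v) (T w) = lorentz v w) \<and> T ` light_cone = light_cone"


section \<open>Smooth maps, surfaces and curves\<close>

primrec Ck_on :: "nat \<Rightarrow> ('a::euclidean_space \<Rightarrow> 'b::real_normed_vector) \<Rightarrow> 'a set \<Rightarrow> bool" where
  "Ck_on 0 f S \<longleftrightarrow> continuous_on S f"
| "Ck_on (Suc k) f S \<longleftrightarrow> (\<forall>x\<in>S. f differentiable (at x)) \<and>
     (\<forall>i\<in>Basis. Ck_on k (\<lambda>x. frechet_derivative f (at x) i) S)"

text \<open>For open sets \<open>S\<close> this says that \<open>f\<close> is \<open>C\<^sup>\<infinity>\<close> on \<open>S\<close>.\<close>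

definition smooth_on :: "('a::euclidean_space \<Rightarrow> 'b::real_normed_vector) \<Rightarrow> 'a set \<Rightarrow> bool" where
  "smooth_on f S \<longleftrightarrow> (\<forall>k. Ck_on k f S)"

text \<open>Parameter domains lie in the plane of \<open>w = u + iv\<close>; partial derivatives in \<open>u\<close> and \<open>v\<close>
  are the directional derivatives along \<open>1\<close> and \<open>\<i>\<close>.\<close>

definition du :: "(complex \<Rightarrow> L4) \<Rightarrow> complex \<Rightarrow> L4" where
  "du X w = frechet_derivative X (at w) 1"

definition dv :: "(complex \<Rightarrow> L4) \<Rightarrow> complex \<Rightarrow> L4" where
  "dv X w = frechet_derivative X (at w) \<i>"

text \<open>The induced metric of \<open>X\<close> is \<open>\<phi>\<^sup>2 (du\<^sup>2 + dv\<^sup>2)\<close>, positive definite; in particular the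
  partial derivatives are linearly independent and \<open>X\<close> is an immersion.\<close>

definition conformal_spacelike_immersion ::
  "complex set \<Rightarrow> (complex \<Rightarrow> L4) \<Rightarrow> (complex \<Rightarrow> real) \<Rightarrow> bool" where
  "conformal_spacelike_immersion D X \<phi> \<longleftrightarrow>
     smooth_on X D \<and> X ` D \<subseteq> light_cone \<and>
     (\<forall>w\<in>D. 0 < \<phi> w \<and>
        lorentz (du X w) (du X w) = (\<phi> w)\<^sup>2 \<and>
        lorentz (dv X w) (dv X w) = (\<phi> w)\<^sup>2 \<and>
        lorentz (du X w) (dv X w) = 0)"

definition gauss_map :: "(complex \<Rightarrow> L4) \<Rightarrow> complex \<Rightarrow> L4" where
  "gauss_map X w = (THE n. lorentz n n = 0 \<and> lorentz n (du X w) = 0 \<and>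
                           lorentz n (dv X w) = 0 \<and> lorentz n (X w) = 1)"

definition mean_curvature :: "(complex \<Rightarrow> L4) \<Rightarrow> (complex \<Rightarrow> real) \<Rightarrow> complex \<Rightarrow> real" where
  "mean_curvature X \<phi> w =
     - (1/2) * (1 / (\<phi> w)\<^sup>2) *
       (lorentz (du X w) (du (gauss_map X) w) + lorentz (dv X w) (dv (gauss_map X) w))"

definition zmc_surface :: "L4 set \<Rightarrow> bool" where
  "zmc_surface S \<longleftrightarrow> (\<exists>D X \<phi>. open D \<and> connected D \<and> D \<noteq> {} \<and>
     conformal_spacelike_immersion D X \<phi> \<and>
     (\<forall>w\<in>D. mean_curvature X \<phi> w = 0) \<and> X ` D = S)"

definition regular_curve :: "real set \<Rightarrow> (real \<Rightarrow> L4) \<Rightarrow> bool" where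
  "regular_curve I \<gamma> \<longleftrightarrow> open I \<and> connected I \<and> I \<noteq> {} \<and> smooth_on \<gamma> I \<and>
     (\<forall>t\<in>I. vector_derivative \<gamma> (at t) \<noteq> 0)"

definition rotation_group :: "L4 set \<Rightarrow> (L4 \<Rightarrow> L4) set" where
  "rotation_group P = {T. cone_isometry T \<and> (\<forall>v\<in>P. T v = v)}"

definition rotational_surface :: "L4 set \<Rightarrow> bool" where
  "rotational_surface S \<longleftrightarrow> (\<exists>P2 P3 I \<gamma>.
     subspace P2 \<and> dim P2 = 2 \<and> subspace P3 \<and> dim P3 = 3 \<and> P2 \<subseteq> P3 \<and>
     P3 \<inter> light_cone \<noteq> {} \<and>
     regular_curve I \<gamma> \<and> \<gamma> ` I \<subseteq> P3 \<inter> light_cone \<and> \<gamma> ` I \<inter> P2 = {} \<and>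
     S = {T (\<gamma> t) |T t. T \<in> rotation_group P2 \<and> t \<in> I})"

text \<open>Surfaces given in matrix form are functions into the Hermitian matrices, defined on the whole
  plane.  \<open>S\<close> is, up to an isometry and a homothety, a piece of \<open>M\<close>:\<close>

definition congruent_to_piece_of :: "L4 set \<Rightarrow> (complex \<Rightarrow> complex^2^2) \<Rightarrow> bool" where
  "congruent_to_piece_of S M \<longleftrightarrow>
     (\<exists>r>0. \<exists>T. cone_isometry T \<and> (\<lambda>p. herm (r *\<^sub>R T p)) ` S \<subseteq> range M)"


section \<open>Weierstrass data\<close>

text \<open>\<open>M = F diag(1,0) F\<^sup>\<star>\<close> with \<open>F : D \<rightarrow> SL(2,\<complex>)\<close> and \<open>dF F\<^sup>-\<^sup>1 = A dw\<close>.  The form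
  \<open>A dw\<close> is of type \<open>(1,0)\<close>, so the entries of \<open>F\<close> have complex derivatives.\<close>

definition has_weierstrass_form ::
  "complex set \<Rightarrow> (complex \<Rightarrow> complex^2^2) \<Rightarrow> (complex \<Rightarrow> complex^2^2) \<Rightarrow> bool" where
  "has_weierstrass_form D M A \<longleftrightarrow> (\<exists>F F' :: complex \<Rightarrow> complex^2^2. \<forall>w\<in>D.
     det (F w) = 1 \<and>
     M w = F w ** mat2 1 0 0 0 ** ctranspose (F w) \<and>
     (\<forall>i j. ((\<lambda>\<zeta>. F \<zeta> $ i $ j) has_field_derivative F' w $ i $ j) (at w)) \<and>
     F' w ** matrix_inv (F w) = A w)"

text \<open>The coefficient of \<open>dw\<close> in the Weierstrass matrix for a value \<open>g\<close> of \<open>G\<close> and \<open>\<Omega> = h dw\<close>.\<close>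

definition weierstrass_matrix :: "complex \<Rightarrow> complex \<Rightarrow> complex^2^2" where
  "weierstrass_matrix g h = mat2 (g * h) (- g\<^sup>2 * h) h (- g * h)"

text \<open>\<open>\<Omega> = h dw\<close>.  At the poles of \<open>G\<close> (more generally, at the isolated points where the function
  \<open>G\<close> is not analytic) the matrix is the holomorphic extension \<open>A\<close>, whose existence also says that
  \<open>G\<^sup>2 \<Omega>\<close> is holomorphic.\<close>

definition has_weierstrass_data ::
  "complex set \<Rightarrow> (complex \<Rightarrow> complex^2^2) \<Rightarrow> (complex \<Rightarrow> complex) \<Rightarrow> (complex \<Rightarrow> complex) \<Rightarrow> bool"
  where
  "has_weierstrass_data D M G h \<longleftrightarrow>
     G meromorphic_on D \<and> h holomorphic_on D \<and>
     (\<exists>A. (\<forall>i j. (\<lambda>w. A w $ i $ j) holomorphic_on D) \<and>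
          (\<forall>w\<in>D. G analytic_on {w} \<longrightarrow> A w = weierstrass_matrix (G w) (h w)) \<and>
          has_weierstrass_form D M A)"


section \<open>The catenoids\<close>

definition elliptic_catenoid :: "real \<Rightarrow> complex \<Rightarrow> complex^2^2" where
  "elliptic_catenoid a w = (let u = of_real (Re w); v = of_real (Im w) in
     mat2 (exp ((of_real a - 2) * v)) (exp (2 * \<i> * u + of_real a * v))
          (exp (- 2 * \<i> * u + of_real a * v)) (exp ((of_real a + 2) * v)))"

definition G_E :: "real \<Rightarrow> complex \<Rightarrow> complex" where
  "G_E a w = (of_real a - 2) / (of_real a + 2) * exp (2 * \<i> * w)"

definition \<Omega>_E :: "real \<Rightarrow> complex \<Rightarrow> complex" where
  "\<Omega>_E a w = - \<i> * (of_real a + 2)\<^sup>2 / 8 * exp (- 2 * \<i> * w)"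

definition hyperbolic_catenoid :: "real \<Rightarrow> complex \<Rightarrow> complex^2^2" where
  "hyperbolic_catenoid b w = (let u = of_real (Re w); v = of_real (Im w) in
     mat2 (exp (2 * u + of_real b * v)) (exp ((of_real b + 2 * \<i>) * v))
          (exp ((of_real b - 2 * \<i>) * v)) (exp (- 2 * u + of_real b * v)))"

definition G_H :: "real \<Rightarrow> complex \<Rightarrow> complex" where
  "G_H b w = (of_real b + 2 * \<i>) / (of_real b - 2 * \<i>) * exp (2 * w)"

definition \<Omega>_H :: "real \<Rightarrow> complex \<Rightarrow> complex" where
  "\<Omega>_H b w = (of_real b - 2 * \<i>)\<^sup>2 / 8 * exp (- 2 * w)"

definition parabolic_catenoid :: "real \<Rightarrow> complex \<Rightarrow> complex^2^2" where
  "parabolic_catenoid c w = (let u = of_real (Re w); v = of_real (Im w) in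
     mat2 (exp (of_real c * v) * (u\<^sup>2 + v\<^sup>2)) (exp (of_real c * v) * (u + \<i> * v))
          (exp (of_real c * v) * (u - \<i> * v)) (exp (of_real c * v)))"

definition G_P :: "real \<Rightarrow> complex \<Rightarrow> complex" where
  "G_P c w = w + 2 * \<i> / of_real c"

definition \<Omega>_P :: "real \<Rightarrow> complex \<Rightarrow> complex" where
  "\<Omega>_P c w = (of_real c)\<^sup>2 / 4"

text \<open>\<open>G_E\<close> is undefined for \<open>a = - 2\<close> and \<open>G_P\<close> for \<open>c = 0\<close>.  The Weierstrass matrices extend to
  these parameters, with entries polynomial in the parameter; the two lemmas below say that
  \<open>weierstrass_E\<close> and \<open>weierstrass_P\<close> are these extensions.\<close>

definition weierstrass_E :: "real \<Rightarrow> complex \<Rightarrow> complex^2^2" where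
  "weierstrass_E a w =
     mat2 (- \<i> * (of_real a - 2) * (of_real a + 2) / 8)
          (\<i> * (of_real a - 2)\<^sup>2 / 8 * exp (2 * \<i> * w))
          (- \<i> * (of_real a + 2)\<^sup>2 / 8 * exp (- 2 * \<i> * w))
          (\<i> * (of_real a - 2) * (of_real a + 2) / 8)"

definition weierstrass_P :: "real \<Rightarrow> complex \<Rightarrow> complex^2^2" where
  "weierstrass_P c w =
     mat2 (of_real c * (of_real c * w + 2 * \<i>) / 4) (- (of_real c * w + 2 * \<i>)\<^sup>2 / 4)
          ((of_real c)\<^sup>2 / 4) (- of_real c * (of_real c * w + 2 * \<i>) / 4)"

lemma weierstrass_E_eq:
  assumes "a \<noteq> - 2"
  shows "weierstrass_E a w = weierstrass_matrix (G_E a w) (\<Omega>_E a w)"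
proof -
  have a: "complex_of_real a + 2 \<noteq> 0"
    using assms by (simp add: complex_eq_iff)
  have e: "exp (- 2 * \<i> * w) = inverse (exp (2 * \<i> * w))"
    by (simp add: exp_minus)
  show ?thesis
    unfolding weierstrass_E_def weierstrass_matrix_def G_E_def \<Omega>_E_def mat2_eq_iff e
    using a by (simp add: divide_simps power2_eq_square)
qed

lemma weierstrass_P_eq:
  assumes "c \<noteq> 0"
  shows "weierstrass_P c w = weierstrass_matrix (G_P c w) (\<Omega>_P c w)"
  unfolding weierstrass_P_def weierstrass_matrix_def G_P_def \<Omega>_P_def mat2_eq_iff
  using assms by (simp add: field_simps power2_eq_square)

end

theory Submission
  imports Defs
begin

no_notation fps_nth (infixl "$" 75)

text \<open>Zero mean curvature means that the Laplacian of \<open>X\<close> is \<open>- 2 \<phi>\<^sup>2 n\<close> with \<open>n\<close> the null Gauss map.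
  Expanding in the frame \<open>X, n, X\<^sub>u, X\<^sub>v\<close> gives, for \<open>f = \<langle>X, N\<rangle>\<close> and \<open>g = \<langle>X, M\<rangle>\<close> with constant \<open>N, M\<close>,
  the identity \<open>f \<Delta>g + g \<Delta>f - 2 \<nabla>f \<cdot> \<nabla>g = - 2 \<phi>\<^sup>2 \<langle>N, M\<rangle>\<close>.  The functions \<open>\<langle>X, N\<rangle>\<close> with \<open>N\<close> in the axis
  \<open>P\<^sup>2\<close> are invariant under the rotations, so any two of them map the domain into a curve and have parallel
  gradients.  In each of the three cases for the induced metric of \<open>P\<^sup>2\<close> the identity turns two functions of
  these coordinates into harmonic ones:
  the logarithms of two null coordinates in the elliptic case, the logarithm of the modulus and the argument of
  \<open>\<langle>X, e\<^sub>1 + \<i> e\<^sub>2\<rangle>\<close> in the hyperbolic case, and \<open>ln \<bar>\<langle>X, N\<rangle>\<bar>\<close> and \<open>\<langle>X, e\<rangle> / \<langle>X, N\<rangle>\<close> in the parabolic case;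
  it also shows that the gradient of one of them has no zeros.  The ratio of the two complex gradients is
  holomorphic and real, hence constant, and the resulting affine relation describes the catenoid up to a
  homothety.\<close>

section \<open>Partial derivatives\<close>

text \<open>The two hypotheses meet only in the equality of two sets: the rotation and the profile
  parameter that produce \<open>X w\<close> are not given as functions of \<open>w\<close>, let
  alone smooth ones, so the surface cannot be reparametrized by orbits. What survives is that
  pairings with the axis depend on the profile parameter alone. Parallelism of their gradients is a
  pointwise real condition; it becomes rigid once the gradients are holomorphic. The domain need not
  be simply connected, and the argument of \<open>\<langle>X, e1 + \<i> e2\<rangle>\<close> may have
  no global branch. Hence only gradients are handled, and primitives enter as single-valued
  functions or under an exponential. One function of each pair must be free of critical points
  whatever the parameter of the catenoid, since it is the denominator of the holomorphic quotient;
  this governs the choice of the pair. The coordinate along the rotation is left undetermined. That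
  is harmless: the parameter \<open>u\<close> of each catenoid sweeps out the whole orbit, and
  nullity supplies the remaining entry of the matrix.\<close>

definition partials :: "(complex \<Rightarrow> 'b::real_normed_vector) \<Rightarrow> 'b \<Rightarrow> 'b \<Rightarrow> complex \<Rightarrow> bool" where
  "partials f a b w \<longleftrightarrow> (f has_derivative (\<lambda>h. Re h *\<^sub>R a + Im h *\<^sub>R b)) (at w)"

lemma partials_unique:
  assumes "partials f a b w" "partials f a' b' w"
  shows "a = a'" "b = b'"
proof -
  have eq: "(\<lambda>h. Re h *\<^sub>R a + Im h *\<^sub>R b) = (\<lambda>h. Re h *\<^sub>R a' + Im h *\<^sub>R b')"
    using assms unfolding partials_def by (rule has_derivative_unique)
  from fun_cong[OF eq, of 1] show "a = a'" by simp
  from fun_cong[OF eq, of \<i>] show "b = b'" by simp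
qed

lemma partials_transfer:
  assumes "partials f a b w" "open D" "w \<in> D" "\<And>z. z \<in> D \<Longrightarrow> f z = g z"
  shows "partials g a b w"
  using assms unfolding partials_def
  by (blast intro: has_derivative_transform_within_open)

lemma partials_const: "partials (\<lambda>_. c) 0 0 w"
  by (simp add: partials_def)

lemma partials_add:
  assumes "partials f a b w" "partials g c d w"
  shows "partials (\<lambda>z. f z + g z) (a + c) (b + d) w"
  using has_derivative_add[OF assms[unfolded partials_def]]
  by (simp add: partials_def algebra_simps)

lemma partials_diff:
  assumes "partials f a b w" "partials g c d w"
  shows "partials (\<lambda>z. f z - g z) (a - c) (b - d) w"
  using has_derivative_diff[OF assms[unfolded partials_def]]
  by (simp add: partials_def algebra_simps)

lemma partials_bilinear:
  assumes B: "bounded_bilinear B" and "partials f a b w" "partials g c d w"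
  shows "partials (\<lambda>z. B (f z) (g z)) (B a (g w) + B (f w) c) (B b (g w) + B (f w) d) w"
proof -
  interpret bounded_bilinear B by fact
  show ?thesis
    using FDERIV[OF assms(2,3)[unfolded partials_def]]
    by (simp add: partials_def add_left add_right scaleR_left scaleR_right algebra_simps)
qed

lemma partials_linear:
  assumes B: "bounded_linear B" and "partials f a b w"
  shows "partials (\<lambda>z. B (f z)) (B a) (B b) w"
proof -
  interpret bounded_linear B by fact
  show ?thesis
    using has_derivative[OF assms(2)[unfolded partials_def]]
    by (simp add: partials_def add scaleR)
qed

lemmas partials_mult = partials_bilinear[OF bounded_bilinear_mult]
lemmas partials_scaleR = partials_bilinear[OF bounded_bilinear_scaleR]
lemmas partials_of_real = partials_linear[OF bounded_linear_of_real]

lemma partials_field_compose: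
  fixes f :: "complex \<Rightarrow> 'b::real_normed_field"
  assumes "(g has_field_derivative g') (at (f w))" "partials f a b w"
  shows "partials (\<lambda>z. g (f z)) (g' * a) (g' * b) w"
  using has_derivative_compose[OF assms(2)[unfolded partials_def]
      assms(1)[unfolded has_field_derivative_def]]
  by (simp add: partials_def algebra_simps)

lemma partials_inverse:
  fixes f :: "complex \<Rightarrow> 'b::real_normed_field"
  assumes "partials f a b w" "f w \<noteq> 0"
  shows "partials (\<lambda>z. inverse (f z)) (- a / (f w)\<^sup>2) (- b / (f w)\<^sup>2) w"
proof -
  have "(inverse has_field_derivative - (inverse (f w) ^ 2)) (at (f w))"
    using DERIV_inverse[OF assms(2)] by (simp add: numeral_2_eq_2)
  from partials_field_compose[OF this assms(1)] show ?thesis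
    by (simp add: field_simps power2_eq_square)
qed

lemma partials_divide:
  fixes f :: "complex \<Rightarrow> 'b::real_normed_field"
  assumes "partials f a b w" "partials g c d w" "g w \<noteq> 0"
  shows "partials (\<lambda>z. f z / g z) ((a * g w - f w * c) / (g w)\<^sup>2) ((b * g w - f w * d) / (g w)\<^sup>2) w"
  using partials_mult[OF assms(1) partials_inverse[OF assms(2,3)]] assms(3)
  by (simp add: divide_inverse[symmetric] diff_divide_distrib power2_eq_square)

lemma partials_exp:
  fixes f :: "complex \<Rightarrow> 'b::{real_normed_field,banach}"
  assumes "partials f a b w"
  shows "partials (\<lambda>z. exp (f z)) (exp (f w) * a) (exp (f w) * b) w"
  by (rule partials_field_compose[OF DERIV_exp assms])

lemma partials_ln:
  fixes f :: "complex \<Rightarrow> real"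
  assumes "partials f a b w" "f w > 0"
  shows "partials (\<lambda>z. ln (f z)) (a / f w) (b / f w) w"
  using partials_field_compose[OF DERIV_ln[OF assms(2)] assms(1)] by (simp add: divide_inverse mult.commute)

lemma partials_differentiable: "partials f a b w \<Longrightarrow> f differentiable (at w)"
  unfolding partials_def differentiable_def by blast

lemma partials_field_derivative:
  assumes "partials K a (\<i> * a) w"
  shows "(K has_field_derivative a) (at w)"
proof -
  have "Re h *\<^sub>R a + Im h *\<^sub>R (\<i> * a) = a * h" for h
    by (simp add: scaleR_conv_of_real complex_eq_iff)
  then show ?thesis
    using assms by (simp add: partials_def has_field_derivative_def)
qed

lemma partials_frechet:
  assumes "f differentiable (at w)"
  shows "partials f (frechet_derivative f (at w) 1) (frechet_derivative f (at w) \<i>) w"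
proof -
  have d: "(f has_derivative frechet_derivative f (at w)) (at w)"
    using assms by (simp add: frechet_derivative_works)
  have lin: "linear (frechet_derivative f (at w))"
    by (rule has_derivative_linear[OF d])
  have "frechet_derivative f (at w) h =
      Re h *\<^sub>R frechet_derivative f (at w) 1 + Im h *\<^sub>R frechet_derivative f (at w) \<i>" for h
  proof -
    have h: "h = Re h *\<^sub>R 1 + Im h *\<^sub>R \<i>" by (simp add: complex_eq_iff)
    have "frechet_derivative f (at w) h = frechet_derivative f (at w) (Re h *\<^sub>R 1 + Im h *\<^sub>R \<i>)"
      by (subst h) (rule refl)
    then show ?thesis
      by (simp add: linear_add[OF lin] linear_scale[OF lin])
  qed
  then have "frechet_derivative f (at w) =
      (\<lambda>h. Re h *\<^sub>R frechet_derivative f (at w) 1 + Im h *\<^sub>R frechet_derivative f (at w) \<i>)"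
    by blast
  with d show ?thesis unfolding partials_def by simp
qed

lemma partials_du_dv:
  assumes "partials X a b w"
  shows "du X w = a" "dv X w = b"
  using partials_unique[OF partials_frechet[OF partials_differentiable[OF assms]] assms]
  by (simp_all add: du_def dv_def)

lemma partials_constant:
  assumes "open D" "connected D" "\<And>w. w \<in> D \<Longrightarrow> partials f 0 0 w" "x \<in> D" "y \<in> D"
  shows "f x = f y"
  by (rule has_derivative_zero_unique_connected[OF assms(1,2) _ assms(4,5)])
    (use assms(3) in \<open>simp add: partials_def\<close>)

section \<open>Symmetry of second derivatives\<close>

lemma second_difference_limit:
  fixes f :: "'a::real_normed_vector \<Rightarrow> real"
  assumes "open S" "w \<in> S"
    and f: "\<And>y. y \<in> S \<Longrightarrow> (f has_derivative f' y) (at y)"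
    and A: "((\<lambda>y. f' y a) has_derivative A) (at w)"
  shows "((\<lambda>h. (f (w + h *\<^sub>R a + h *\<^sub>R b) - f (w + h *\<^sub>R a) - f (w + h *\<^sub>R b) + f w) / h\<^sup>2) \<longlongrightarrow> A b)
           (at_right 0)"
proof (rule tendstoI)
  fix e :: real assume "e > 0"
  \<comment> \<open>The two error terms below are bounded by multiples of
    \<open>h * (norm a + norm b)\<close> and \<open>h * norm a\<close>, which add up to less than
    \<open>h * K\<close>; the summand 1 keeps \<open>K\<close> positive when both vectors
    vanish.\<close>
  define K where "K = 2 * norm a + norm b + 1"
  have K: "K > 0" by (simp add: K_def add_nonneg_pos)
  define e' where "e' = e / (2 * K)"
  have e': "e' > 0" using \<open>e > 0\<close> K by (simp add: e'_def)
  interpret A: bounded_linear A using A by (rule has_derivative_bounded_linear)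
  obtain d1 where d1: "d1 > 0" "\<And>y. norm (y - w) < d1 \<Longrightarrow>
      norm (f' y a - f' w a - A (y - w)) \<le> e' * norm (y - w)"
    using A[unfolded has_derivative_at_alt] e' by blast
  obtain d2 where d2: "d2 > 0" "ball w d2 \<subseteq> S"
    using assms(1,2) openE by blast
  define d where "d = min d1 d2 / K"
  have d: "d > 0" using d1 d2 K by (simp add: d_def)
  show "eventually (\<lambda>h. dist ((f (w + h *\<^sub>R a + h *\<^sub>R b) - f (w + h *\<^sub>R a) - f (w + h *\<^sub>R b) + f w) / h\<^sup>2)
      (A b) < e) (at_right 0)"
    unfolding eventually_at_right_field
  proof (intro exI[of _ d] conjI allI impI)
    fix h :: real assume h: "0 < h" "h < d"
    have small: "norm (s *\<^sub>R a + t *\<^sub>R b) \<le> h * (norm a + norm b)"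
      "norm (s *\<^sub>R a + t *\<^sub>R b) < min d1 d2"
      if "0 \<le> s" "s \<le> h" "0 \<le> t" "t \<le> h" for s t
    proof -
      have "norm (s *\<^sub>R a + t *\<^sub>R b) \<le> s * norm a + t * norm b"
        using norm_triangle_ineq[of "s *\<^sub>R a" "t *\<^sub>R b"] that by simp
      also have "\<dots> \<le> h * norm a + h * norm b"
        using that by (intro add_mono mult_right_mono) auto
      finally show 1: "norm (s *\<^sub>R a + t *\<^sub>R b) \<le> h * (norm a + norm b)"
        by (simp add: algebra_simps)
      have "h * (norm a + norm b) \<le> h * K"
        using h by (intro mult_left_mono) (auto simp: K_def)
      also have "\<dots> < min d1 d2"
        using h K by (simp add: d_def field_simps)
      finally show "norm (s *\<^sub>R a + t *\<^sub>R b) < min d1 d2" using 1 by linarith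
    qed
    have inS: "w + s *\<^sub>R a + t *\<^sub>R b \<in> S" if "0 \<le> s" "s \<le> h" "0 \<le> t" "t \<le> h" for s t
      using small(2)[OF that] d2(2) by (auto simp: dist_norm subset_iff norm_minus_commute)
    \<comment> \<open>The second difference is the increment of this first difference in direction
      \<open>b\<close>, so the mean value theorem in direction \<open>a\<close> reduces it to a
      difference of two values of \<open>f' _ a\<close>.\<close>
    define \<phi> where "\<phi> s = f (w + s *\<^sub>R a + h *\<^sub>R b) - f (w + s *\<^sub>R a)" for s
    have der: "(\<phi> has_real_derivative (f' (w + s *\<^sub>R a + h *\<^sub>R b) a - f' (w + s *\<^sub>R a) a)) (at s)"
      if s: "0 \<le> s" "s \<le> h" for s
    proof -
      have 1: "(f has_derivative f' (w + s *\<^sub>R a + t *\<^sub>R b)) (at (w + s *\<^sub>R a + t *\<^sub>R b))"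
        if "0 \<le> t" "t \<le> h" for t
        using f inS s that by blast
      have 2: "((\<lambda>s. f (w + s *\<^sub>R a + t *\<^sub>R b)) has_real_derivative f' (w + s *\<^sub>R a + t *\<^sub>R b) a) (at s)"
        if t: "0 \<le> t" "t \<le> h" for t
      proof -
        have "((\<lambda>s. w + s *\<^sub>R a + t *\<^sub>R b) has_derivative (\<lambda>x. x *\<^sub>R a)) (at s)"
          by (auto intro!: derivative_eq_intros)
        from has_derivative_compose[OF this 1[OF t]] show ?thesis
          using linear_scale[OF has_derivative_linear[OF 1[OF t]]]
          by (simp add: has_field_derivative_def mult.commute[of _ "f' _ a"])
      qed
      show ?thesis
        unfolding \<phi>_def using DERIV_diff[OF 2[of h] 2[of 0]] h by simp
    qed
    obtain x where x: "0 < x" "x < h" "\<phi> h - \<phi> 0 = (h - 0) *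
        (f' (w + x *\<^sub>R a + h *\<^sub>R b) a - f' (w + x *\<^sub>R a) a)"
      using MVT2[of 0 h \<phi>, OF h(1) der] by auto
    have b1: "norm (f' (w + x *\<^sub>R a + t *\<^sub>R b) a - f' w a - A (x *\<^sub>R a + t *\<^sub>R b)) \<le> e' * (h * (norm a + norm b))"
      if "0 \<le> t" "t \<le> h" for t
    proof -
      have "norm (f' (w + x *\<^sub>R a + t *\<^sub>R b) a - f' w a - A (x *\<^sub>R a + t *\<^sub>R b))
          \<le> e' * norm (x *\<^sub>R a + t *\<^sub>R b)"
        using d1(2)[of "w + x *\<^sub>R a + t *\<^sub>R b"] small(2)[of x t] x that by (simp add: add.assoc)
      also have "\<dots> \<le> e' * (h * (norm a + norm b))"
        using small(1)[of x t] x that e' by (intro mult_left_mono) auto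
      finally show ?thesis .
    qed
    let ?D = "f' (w + x *\<^sub>R a + h *\<^sub>R b) a - f' (w + x *\<^sub>R a) a"
    have b2: "norm (f' (w + x *\<^sub>R a) a - f' w a - A (x *\<^sub>R a)) \<le> e' * (h * norm a)"
    proof -
      have n: "norm (x *\<^sub>R a) \<le> h * norm a" using x by (simp add: mult_right_mono)
      have "norm (f' (w + x *\<^sub>R a) a - f' w a - A (x *\<^sub>R a)) \<le> e' * norm (x *\<^sub>R a)"
        using d1(2)[of "w + x *\<^sub>R a"] small(2)[of x 0] x by simp
      also have "\<dots> \<le> e' * (h * norm a)" using n e' by (intro mult_left_mono) auto
      finally show ?thesis .
    qed
    \<comment> \<open>In the difference of the two linear approximations, \<open>f' w a\<close> and
      \<open>A (x *\<^sub>R a)\<close> cancel. The unknown intermediate point \<open>x\<close> drops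
      out and \<open>h * A b\<close> remains.\<close>
    have "\<bar>?D - h * A b\<bar> \<le> e' * (h * (norm a + norm b)) + e' * (h * norm a)"
      using b1[of h] b2 h by (simp add: A.add A.scaleR)
    also have "\<dots> \<le> e' * (h * K)"
      using e' h by (simp add: K_def algebra_simps)
    also have "\<dots> = h * (e / 2)" using K by (simp add: e'_def)
    finally have 3: "\<bar>?D - h * A b\<bar> \<le> h * (e / 2)" .
    have "(\<phi> h - \<phi> 0) / h\<^sup>2 - A b = (?D - h * A b) / h"
      unfolding x(3) using h by (simp add: diff_divide_distrib power2_eq_square)
    then have "\<bar>(\<phi> h - \<phi> 0) / h\<^sup>2 - A b\<bar> = \<bar>?D - h * A b\<bar> / h"
      using h by (simp add: abs_divide)
    also have "\<dots> \<le> e / 2"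
      using 3 h by (simp add: divide_le_eq mult.commute)
    also have "e / 2 < e" using \<open>e > 0\<close> by simp
    finally show "dist ((f (w + h *\<^sub>R a + h *\<^sub>R b) - f (w + h *\<^sub>R a) - f (w + h *\<^sub>R b) + f w) / h\<^sup>2) (A b) < e"
      by (simp add: \<phi>_def dist_real_def algebra_simps)
  qed (rule d)
qed

text \<open>The second difference is symmetric in \<open>a\<close> and \<open>b\<close>, so both
  sides are its limit.\<close>

lemma second_derivative_symmetric:
  fixes f :: "'a::real_normed_vector \<Rightarrow> real"
  assumes "open S" "w \<in> S"
    and f: "\<And>y. y \<in> S \<Longrightarrow> (f has_derivative f' y) (at y)"
    and A: "((\<lambda>y. f' y a) has_derivative A) (at w)"
    and B: "((\<lambda>y. f' y b) has_derivative B) (at w)"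
  shows "A b = B a"
proof -
  have "((\<lambda>h. (f (w + h *\<^sub>R a + h *\<^sub>R b) - f (w + h *\<^sub>R a) - f (w + h *\<^sub>R b) + f w) / h\<^sup>2) \<longlongrightarrow> B a)
           (at_right 0)"
    using second_difference_limit[OF assms(1-3) B, of a] by (simp add: algebra_simps)
  with second_difference_limit[OF assms(1-3) A, of b] show ?thesis
    using tendsto_unique trivial_limit_at_right_real by blast
qed

lemma partials_symmetric:
  fixes X :: "complex \<Rightarrow> 'b::euclidean_space"
  assumes "open D" "w \<in> D"
    and X: "\<And>z. z \<in> D \<Longrightarrow> partials X (U z) (V z) z"
    and U: "partials U a b w" and V: "partials V c d w"
  shows "b = c"
proof (rule euclidean_eqI)
  fix e :: 'b
  have "(\<lambda>h. Re h * (a \<bullet> e) + Im h * (b \<bullet> e)) \<i> = (\<lambda>h. Re h * (c \<bullet> e) + Im h * (d \<bullet> e)) 1"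
  proof (rule second_derivative_symmetric[OF assms(1,2),
        where f = "\<lambda>z. X z \<bullet> e" and f' = "\<lambda>z h. Re h * (U z \<bullet> e) + Im h * (V z \<bullet> e)"])
    show "((\<lambda>z. X z \<bullet> e) has_derivative (\<lambda>h. Re h * (U z \<bullet> e) + Im h * (V z \<bullet> e))) (at z)"
      if "z \<in> D" for z
      using partials_linear[OF bounded_linear_inner_left X[OF that], of e] by (simp add: partials_def)
    show "((\<lambda>z. Re 1 * (U z \<bullet> e) + Im 1 * (V z \<bullet> e)) has_derivative
        (\<lambda>h. Re h * (a \<bullet> e) + Im h * (b \<bullet> e))) (at w)"
      using partials_linear[OF bounded_linear_inner_left U, of e] by (simp add: partials_def)
    show "((\<lambda>z. Re \<i> * (U z \<bullet> e) + Im \<i> * (V z \<bullet> e)) has_derivative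
        (\<lambda>h. Re h * (c \<bullet> e) + Im h * (d \<bullet> e))) (at w)"
      using partials_linear[OF bounded_linear_inner_left V, of e] by (simp add: partials_def)
  qed
  then show "b \<bullet> e = c \<bullet> e" by simp
qed

lemma smooth_on_partials:
  assumes "smooth_on X D"
  shows "smooth_on (du X) D" "smooth_on (dv X) D"
    and "w \<in> D \<Longrightarrow> partials X (du X w) (dv X w) w"
proof -
  have S: "Ck_on (Suc k) X D" for k
    using assms by (simp add: smooth_on_def)
  have du: "du X = (\<lambda>x. frechet_derivative X (at x) 1)"
    and dv: "dv X = (\<lambda>x. frechet_derivative X (at x) \<i>)"
    by (simp_all add: fun_eq_iff du_def dv_def)
  show "smooth_on (du X) D" "smooth_on (dv X) D"
    using S by (auto simp: smooth_on_def du dv Basis_complex_def)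
  show "partials X (du X w) (dv X w) w" if "w \<in> D"
    using S[of 0] that partials_frechet by (auto simp: du_def dv_def)
qed

text \<open>The partial derivatives of \<open>f\<close> are \<open>f'\<close> and
  \<open>\<i> * f'\<close>; when the imaginary part of \<open>f\<close> vanishes, so do the
  imaginary parts of both, hence \<open>f' = 0\<close>.\<close>

lemma real_holomorphic_constant:
  assumes "open D" "connected D" "f holomorphic_on D" "\<And>w. w \<in> D \<Longrightarrow> Im (f w) = 0"
    and "x \<in> D" "y \<in> D"
  shows "f x = f y"
proof -
  have "partials f 0 0 w" if w: "w \<in> D" for w
  proof -
    obtain f' where f': "(f has_field_derivative f') (at w)"
      using assms(1,3) w by (auto simp: holomorphic_on_open)
    have p: "partials f f' (\<i> * f') w"
    proof -
      have "Re h *\<^sub>R f' + Im h *\<^sub>R (\<i> * f') = f' * h" for h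
        by (simp add: scaleR_conv_of_real complex_eq_iff)
      then show ?thesis using f' by (simp add: partials_def has_field_derivative_def)
    qed
    have "partials (\<lambda>z. Im (f z)) 0 0 w"
      by (rule partials_transfer[OF partials_const assms(1) w, of 0]) (simp add: assms(4))
    from partials_unique[OF partials_linear[OF bounded_linear_Im p] this]
    have "f' = 0" by (simp add: complex_eq_iff)
    with p show ?thesis by simp
  qed
  with assms(1,2,5,6) show ?thesis by (blast intro: partials_constant)
qed

text \<open>If \<open>p\<close> and \<open>q\<close> are the complex gradients \<open>f\<^sub>u - \<i> f\<^sub>v\<close> of two harmonic functions, the last hypothesis
  says that the real gradients are parallel; \<open>p / q\<close> is then holomorphic and real.\<close>

lemma proportional_gradients:
  assumes "open D" "connected D" "D \<noteq> {}" "p holomorphic_on D" "q holomorphic_on D"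
    and q: "\<And>w. w \<in> D \<Longrightarrow> q w \<noteq> 0" and real: "\<And>w. w \<in> D \<Longrightarrow> Im (p w * cnj (q w)) = 0"
  obtains l :: real where "\<And>w. w \<in> D \<Longrightarrow> p w = of_real l * q w"
proof -
  obtain w0 where w0: "w0 \<in> D" using assms(3) by blast
  have "(\<lambda>w. p w / q w) holomorphic_on D"
    using assms(4,5) q by (intro holomorphic_intros) auto
  moreover have im: "Im (p w / q w) = 0" if "w \<in> D" for w
  proof -
    have "p w / q w = (p w * cnj (q w)) / of_real ((cmod (q w))\<^sup>2)"
      using q[OF that] by (simp add: complex_norm_square field_simps del: of_real_power)
    then show ?thesis using real[OF that] by simp
  qed
  ultimately have c: "p w / q w = p w0 / q w0" if "w \<in> D" for w
    using real_holomorphic_constant[OF assms(1,2)] that w0 by blast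
  show ?thesis
  proof (rule that)
    fix w assume w: "w \<in> D"
    have "p w0 / q w0 = of_real (Re (p w0 / q w0))"
      using im[OF w0] by (simp add: complex_eq_iff)
    then show "p w = of_real (Re (p w0 / q w0)) * q w"
      using c[OF w] q[OF w] by (metis nonzero_divide_eq_eq)
  qed
qed

section \<open>Lorentz frames\<close>

lemma lorentz_simps:
  "lorentz (u + v) w = lorentz u w + lorentz v w" "lorentz w (u + v) = lorentz w u + lorentz w v"
  "lorentz (u - v) w = lorentz u w - lorentz v w" "lorentz w (u - v) = lorentz w u - lorentz w v"
  "lorentz (- v) w = - lorentz v w" "lorentz w (- v) = - lorentz w v"
  "lorentz (c *\<^sub>R v) w = c * lorentz v w" "lorentz w (c *\<^sub>R v) = c * lorentz w v"
  "lorentz 0 w = 0" "lorentz w 0 = 0"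
  by (simp_all add: lorentz_def algebra_simps)

lemma lorentz_commute: "lorentz v w = lorentz w v"
  by (simp add: lorentz_def)

lemma bounded_bilinear_lorentz: "bounded_bilinear lorentz"
proof -
  have "bilinear lorentz"
    unfolding bilinear_def by (auto intro!: linearI simp: lorentz_simps)
  then show ?thesis by (simp add: bilinear_conv_bounded_bilinear)
qed

lemmas partials_lorentz = partials_bilinear[OF bounded_bilinear_lorentz]

lemma partials_lorentz_const:
  assumes "partials X a b w"
  shows "partials (\<lambda>z. lorentz (X z) N) (lorentz a N) (lorentz b N) w"
  using partials_lorentz[OF assms partials_const] by (simp add: lorentz_simps)

text \<open>Lorentz orthogonality is Euclidean orthogonality to the time-reflected vector, which
  makes Euclidean orthogonal complements available.\<close>

lemma lorentz_inner: "lorentz v w = v \<bullet> (\<chi> i. if i = 1 then - w $ 1 else w $ i)"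
  by (simp add: lorentz_def inner_vec_def sum_4)

lemma light_cone_iff: "v \<in> light_cone \<longleftrightarrow> lorentz v v = 0 \<and> 0 < v $ 1"
  by (simp add: light_cone_def herm_def trace_def sum_2)

lemma spatial_Cauchy_Schwarz:
  "(v$2 * w$2 + v$3 * w$3 + v$4 * w$4)\<^sup>2
     \<le> ((v$2)\<^sup>2 + (v$3)\<^sup>2 + (v$4)\<^sup>2) * ((w$2)\<^sup>2 + (w$3)\<^sup>2 + (w$4)\<^sup>2)" for v w :: L4
proof -
  have "((v$2)\<^sup>2 + (v$3)\<^sup>2 + (v$4)\<^sup>2) * ((w$2)\<^sup>2 + (w$3)\<^sup>2 + (w$4)\<^sup>2)
      - (v$2 * w$2 + v$3 * w$3 + v$4 * w$4)\<^sup>2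
    = (v$2 * w$3 - v$3 * w$2)\<^sup>2 + (v$2 * w$4 - v$4 * w$2)\<^sup>2 + (v$3 * w$4 - v$4 * w$3)\<^sup>2"
    by (simp add: power2_eq_square algebra_simps)
  also have "\<dots> \<ge> 0" by simp
  finally show ?thesis by simp
qed

text \<open>Orthogonality expresses the time component product as a spatial inner product.
  Cauchy-Schwarz and the strict inequality for \<open>T\<close> then bound the time component of
  \<open>v\<close> by its spatial length.\<close>

lemma timelike_orthogonal:
  assumes T: "lorentz T T < 0" and vT: "lorentz v T = 0" and "v \<noteq> 0"
  shows "lorentz v v > 0"
proof -
  define s where "s = (v$2)\<^sup>2 + (v$3)\<^sup>2 + (v$4)\<^sup>2"
  define t where "t = (T$2)\<^sup>2 + (T$3)\<^sup>2 + (T$4)\<^sup>2"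
  have t: "t < (T$1)\<^sup>2" using T by (simp add: lorentz_def t_def power2_eq_square)
  have t0: "t \<ge> 0" by (simp add: t_def)
  have "(v$1 * T$1)\<^sup>2 = (v$2 * T$2 + v$3 * T$3 + v$4 * T$4)\<^sup>2"
  proof -
    have "v$1 * T$1 = v$2 * T$2 + v$3 * T$3 + v$4 * T$4"
      using vT by (simp add: lorentz_def)
    then show ?thesis by simp
  qed
  also have "\<dots> \<le> s * t" unfolding s_def t_def by (rule spatial_Cauchy_Schwarz)
  finally have le: "(v$1)\<^sup>2 * (T$1)\<^sup>2 \<le> s * t" by (simp add: power_mult_distrib)
  have s0: "s > 0"
  proof (rule ccontr)
    assume "\<not> s > 0"
    then have s: "s = 0" by (simp add: s_def add_nonneg_nonneg order.antisym not_less)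
    then have "(v$2)\<^sup>2 + ((v$3)\<^sup>2 + (v$4)\<^sup>2) = 0" by (simp add: s_def)
    then have "v$2 = 0" "v$3 = 0" "v$4 = 0"
      by (auto simp: add_nonneg_eq_0_iff)
    moreover have "v$1 = 0"
    proof -
      have "(v$1)\<^sup>2 * (T$1)\<^sup>2 = 0"
        using le mult_nonneg_nonneg[OF zero_le_power2[of "v$1"] zero_le_power2[of "T$1"]]
        unfolding s by linarith
      moreover have "(T$1)\<^sup>2 \<noteq> 0" using t t0 by linarith
      ultimately show ?thesis by simp
    qed
    ultimately have "v = 0" by (simp add: vec_eq_iff forall_4)
    with \<open>v \<noteq> 0\<close> show False ..
  qed
  have "(v$1)\<^sup>2 * (T$1)\<^sup>2 < s * (T$1)\<^sup>2"
    using le mult_strict_left_mono[OF t s0] by linarith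
  then have "(v$1)\<^sup>2 < s"
    using mult_less_cancel_right_disj[of "(v$1)\<^sup>2" "(T$1)\<^sup>2" s] by simp
  then show ?thesis by (simp add: lorentz_def s_def power2_eq_square)
qed

lemma timelike_cone_negative:
  assumes T: "lorentz T T < 0" "T $ 1 > 0" and X: "X \<in> light_cone"
  shows "lorentz X T < 0"
proof -
  define t where "t = (T$2)\<^sup>2 + (T$3)\<^sup>2 + (T$4)\<^sup>2"
  have X': "(X$2)\<^sup>2 + (X$3)\<^sup>2 + (X$4)\<^sup>2 = (X$1)\<^sup>2" "X$1 > 0"
    using X by (auto simp: light_cone_iff lorentz_def power2_eq_square)
  have t: "t < (T$1)\<^sup>2" using T by (simp add: lorentz_def t_def power2_eq_square)
  have "(X$2 * T$2 + X$3 * T$3 + X$4 * T$4)\<^sup>2 \<le> (X$1)\<^sup>2 * t"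
    using spatial_Cauchy_Schwarz[of X T] by (simp add: X' t_def)
  also have "\<dots> < (X$1 * T$1)\<^sup>2"
    using t X' by (simp add: power_mult_distrib)
  finally have "X$2 * T$2 + X$3 * T$3 + X$4 * T$4 < X$1 * T$1"
    using power_less_imp_less_base X'(2) T(2) by (metis less_imp_le mult_nonneg_nonneg)
  then show ?thesis by (simp add: lorentz_def)
qed

text \<open>The combination of \<open>X\<close> and \<open>N\<close> that cancels the time
  components is again null, and a null vector without time component is zero.\<close>

lemma null_orthogonal_parallel:
  assumes X: "lorentz X X = 0" and N: "lorentz N N = 0" "N \<noteq> 0" and o: "lorentz X N = 0"
  shows "\<exists>k. X = k *\<^sub>R N"
proof -
  define D where "D = N$1 *\<^sub>R X - X$1 *\<^sub>R N"
  have D1: "D$1 = 0" by (simp add: D_def)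
  have "lorentz D D = 0"
    using X N o lorentz_commute[of X N] by (simp add: D_def lorentz_simps)
  then have "(D$2)\<^sup>2 + ((D$3)\<^sup>2 + (D$4)\<^sup>2) = 0"
    by (simp add: lorentz_def D1 power2_eq_square)
  then have D: "D = 0"
    using D1 by (auto simp: add_nonneg_eq_0_iff vec_eq_iff forall_4)
  have N1: "N$1 \<noteq> 0"
  proof
    assume z: "N$1 = 0"
    then have "(N$2)\<^sup>2 + ((N$3)\<^sup>2 + (N$4)\<^sup>2) = 0"
      using N(1) by (simp add: lorentz_def power2_eq_square)
    then have "N = 0" using z by (auto simp: add_nonneg_eq_0_iff vec_eq_iff forall_4)
    with N(2) show False ..
  qed
  have "X = (X$1 / N$1) *\<^sub>R N"
    using D N1 by (simp add: D_def vec_eq_iff field_simps)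
  then show ?thesis ..
qed

lemma lorentz_orthogonal_exists:
  assumes "finite B" "card B \<le> 3"
  obtains v where "v \<noteq> 0" "\<And>b. b \<in> B \<Longrightarrow> lorentz v b = 0"
proof -
  let ?J = "\<lambda>w::L4. (\<chi> i. if i = 1 then - w $ 1 else w $ i) :: L4"
  have "dim (?J ` B) \<le> 3"
    using dim_le_card'[of "?J ` B"] card_image_le[of B ?J] assms by auto
  then have "dim (?J ` B) < DIM(L4)" by simp
  then obtain v where "v \<noteq> 0" "\<And>y. y \<in> span (?J ` B) \<Longrightarrow> orthogonal v y"
    using orthogonal_to_subspace_exists by blast
  then show ?thesis
    using that by (auto simp: lorentz_inner orthogonal_def span_base)
qed

section \<open>Orthonormal frames and their coordinates\<close>

definition lorentz_frame :: "L4 \<Rightarrow> L4 \<Rightarrow> L4 \<Rightarrow> L4 \<Rightarrow> bool" where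
  "lorentz_frame T E2 E3 E4 \<longleftrightarrow> T $ 1 > 0 \<and> lorentz T T = - 1 \<and>
     lorentz E2 E2 = 1 \<and> lorentz E3 E3 = 1 \<and> lorentz E4 E4 = 1 \<and>
     lorentz E2 T = 0 \<and> lorentz E3 T = 0 \<and> lorentz E4 T = 0 \<and>
     lorentz E2 E3 = 0 \<and> lorentz E2 E4 = 0 \<and> lorentz E3 E4 = 0"

text \<open>For an orthonormal frame these are the coefficients of \<open>p\<close>; the first sign
  compensates \<open>lorentz T T = - 1\<close>.\<close>

definition frame_coords :: "L4 \<Rightarrow> L4 \<Rightarrow> L4 \<Rightarrow> L4 \<Rightarrow> L4 \<Rightarrow> L4" where
  "frame_coords T E2 E3 E4 p =
     (\<chi> i. if i = 1 then - lorentz p T else if i = 2 then lorentz p E2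
           else if i = 3 then lorentz p E3 else lorentz p E4)"

lemma frame_coords_nth [simp]:
  "frame_coords T E2 E3 E4 p $ 1 = - lorentz p T" "frame_coords T E2 E3 E4 p $ 2 = lorentz p E2"
  "frame_coords T E2 E3 E4 p $ 3 = lorentz p E3" "frame_coords T E2 E3 E4 p $ 4 = lorentz p E4"
  by (simp_all add: frame_coords_def)

text \<open>The expansion map \<open>L\<close> is a right inverse, hence injective, and by dimension
  surjective; so orthonormality carries over to all vectors. For surjectivity on the cone, a
  preimage \<open>L q\<close> in the past cone is impossible: its negative would lie in the light
  cone and be sent to \<open>- q\<close>.\<close>

lemma cone_isometry_frame_coords:
  assumes "lorentz_frame T E2 E3 E4"
  shows "cone_isometry (frame_coords T E2 E3 E4)"
proof -
  let ?C = "frame_coords T E2 E3 E4"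
  define L :: "L4 \<Rightarrow> L4" where "L c = c$1 *\<^sub>R T + c$2 *\<^sub>R E2 + c$3 *\<^sub>R E3 + c$4 *\<^sub>R E4" for c
  note fr = assms[unfolded lorentz_frame_def]
  have fr': "lorentz T E2 = 0" "lorentz T E3 = 0" "lorentz T E4 = 0" "lorentz E3 E2 = 0"
    "lorentz E4 E2 = 0" "lorentz E4 E3 = 0"
    using fr by (simp_all add: lorentz_commute)
  have CL: "?C (L c) = c" for c
    using fr fr' by (simp add: vec_eq_iff forall_4 L_def lorentz_simps)
  have "linear L" by (rule linearI) (simp_all add: L_def algebra_simps)
  moreover have "inj L" by (metis CL injI)
  ultimately have "surj L" by (simp add: linear_injective_imp_surjective)
  have lin: "linear ?C"
    by (rule linearI) (simp_all add: vec_eq_iff forall_4 lorentz_simps)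
  have pres: "lorentz (?C v) (?C w) = lorentz v w" for v w
  proof -
    obtain c d where "v = L c" "w = L d" using \<open>surj L\<close> by (meson surjD)
    moreover have "lorentz (L c) (L d) = lorentz c d"
      using fr fr' by (simp add: L_def lorentz_simps) (simp add: lorentz_def)
    ultimately show ?thesis by (simp add: CL)
  qed
  have into: "?C v \<in> light_cone" if "v \<in> light_cone" for v
    using that timelike_cone_negative[of T v] fr pres[of v v] by (auto simp: light_cone_iff)
  have "?C ` light_cone = light_cone"
  proof
    show "?C ` light_cone \<subseteq> light_cone" using into by blast
    show "light_cone \<subseteq> ?C ` light_cone"
    proof
      fix q assume q: "q \<in> light_cone"
      have C: "?C (L q) = q" by (rule CL)
      have null: "lorentz (L q) (L q) = 0"
        using pres[of "L q" "L q"] q by (simp add: C light_cone_iff)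
      have "L q $ 1 > 0"
      proof (rule ccontr)
        assume "\<not> L q $ 1 > 0"
        moreover have "L q $ 1 \<noteq> 0"
        proof
          assume z: "L q $ 1 = 0"
          then have "(L q$2)\<^sup>2 + ((L q$3)\<^sup>2 + (L q$4)\<^sup>2) = 0"
            using null by (simp add: lorentz_def power2_eq_square)
          then have "L q = 0" using z by (auto simp: add_nonneg_eq_0_iff vec_eq_iff forall_4)
          then have "q = 0" using C linear_0[OF lin] by simp
          with q show False by (simp add: light_cone_iff)
        qed
        ultimately have "- L q \<in> light_cone"
          using null by (simp add: light_cone_iff lorentz_simps)
        from into[OF this] have "- q \<in> light_cone" by (simp add: linear_neg[OF lin] C)
        with q show False by (simp add: light_cone_iff)
      qed
      with null have "L q \<in> light_cone" by (simp add: light_cone_iff)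
      then show "q \<in> ?C ` light_cone" using C by force
    qed
  qed
  with lin pres show ?thesis by (simp add: cone_isometry_def)
qed

text \<open>The Gram matrix is a hyperbolic plane spanned by \<open>X\<close> and \<open>n\<close>
  plus \<open>s\<close> times the identity. Hence the coefficient along \<open>X\<close> is the
  pairing with \<open>n\<close> and vice versa; the same pairings show that the four vectors form a
  basis. This serves both for the uniqueness of the Gauss map and for the Laplace identity.\<close>

lemma null_frame_gram:
  assumes gram: "lorentz X X = 0" "lorentz n n = 0" "lorentz n X = 1" "lorentz U U = s" "lorentz V V = s"
    "lorentz U V = 0" "lorentz U X = 0" "lorentz V X = 0" "lorentz n U = 0" "lorentz n V = 0"
    and s: "s \<noteq> 0"
  shows "lorentz N M = lorentz N n * lorentz M X + lorentz N X * lorentz M n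
           + (lorentz N U * lorentz M U + lorentz N V * lorentz M V) / s"
proof -
  define L :: "L4 \<Rightarrow> L4" where "L c = c$1 *\<^sub>R X + c$2 *\<^sub>R n + c$3 *\<^sub>R U + c$4 *\<^sub>R V" for c
  have gram': "lorentz X n = 1" "lorentz V U = 0" "lorentz X U = 0" "lorentz X V = 0"
    "lorentz U n = 0" "lorentz V n = 0"
    using gram by (simp_all add: lorentz_commute)
  have C: "lorentz (L c) n = c$1" "lorentz (L c) X = c$2" "lorentz (L c) U = s * c$3"
      "lorentz (L c) V = s * c$4" for c
    using gram gram' by (simp_all add: L_def lorentz_simps)
  have lin: "linear L" by (rule linearI) (simp_all add: L_def algebra_simps)
  have "inj L"
  proof (rule injI)
    fix c d assume q: "L c = L d"
    then show "c = d" using C[of c, unfolded q] C[of d] s by (simp add: vec_eq_iff forall_4)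
  qed
  with lin have "surj L" by (simp add: linear_injective_imp_surjective)
  then obtain c where c: "N = L c" by (meson surjD)
  have "lorentz N M = c$1 * lorentz M X + c$2 * lorentz M n + c$3 * lorentz M U + c$4 * lorentz M V"
    by (simp add: c L_def lorentz_simps lorentz_commute[of _ M])
  then show ?thesis using C[of c] s by (simp add: c add_divide_distrib)
qed

lemma lorentz_frame_extend_spatial:
  assumes "T $ 1 > 0" "lorentz T T = - 1" "lorentz E3 E3 = 1" "lorentz E4 E4 = 1"
    "lorentz E3 T = 0" "lorentz E4 T = 0" "lorentz E3 E4 = 0"
  obtains E2 where "lorentz_frame T E2 E3 E4"
proof -
  obtain v where v: "v \<noteq> 0" "\<And>b. b \<in> {T, E3, E4} \<Longrightarrow> lorentz v b = 0"
    by (rule lorentz_orthogonal_exists[of "{T, E3, E4}"]) (auto simp: card_insert_if)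
  then have p: "lorentz v v > 0" using timelike_orthogonal[of T v] assms by simp
  let ?E = "(1 / sqrt (lorentz v v)) *\<^sub>R v"
  have "lorentz ?E ?E = 1" using p by (simp add: lorentz_simps)
  with v assms have "lorentz_frame T ?E E3 E4" by (simp add: lorentz_frame_def lorentz_simps)
  then show ?thesis ..
qed

lemma unit_spatial_exists:
  assumes "lorentz T T < 0"
  obtains E' where "lorentz E' E' = 1" "lorentz E' T = 0" "lorentz E' E = 0"
proof -
  obtain v where v: "v \<noteq> 0" "\<And>b. b \<in> {T, E} \<Longrightarrow> lorentz v b = 0"
    by (rule lorentz_orthogonal_exists[of "{T, E}"]) (auto simp: card_insert_if)
  then have p: "lorentz v v > 0" using timelike_orthogonal[of T v] assms by simp
  show ?thesis
    by (rule that[of "(1 / sqrt (lorentz v v)) *\<^sub>R v"]) (use p v in \<open>simp_all add: lorentz_simps\<close>)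
qed

lemma unit_timelike_exists:
  assumes "lorentz T T < 0"
  obtains c where "(c *\<^sub>R T) $ 1 > 0" "lorentz (c *\<^sub>R T) (c *\<^sub>R T) = - 1"
proof -
  have T1: "T $ 1 \<noteq> 0"
  proof
    assume "T $ 1 = 0"
    then have "lorentz T T \<ge> 0" by (simp add: lorentz_def)
    with assms show False by simp
  qed
  show ?thesis
    by (rule that[of "sgn (T $ 1) / sqrt (- lorentz T T)"])
      (use T1 assms in \<open>simp_all add: lorentz_simps sgn_if field_simps\<close>)
qed

section \<open>Frames adapted to a plane, by its induced metric\<close>

lemma second_independent_vector:
  fixes P :: "L4 set"
  assumes "dim P = 2"
  obtains w where "w \<in> P" "w \<notin> span {v}"
proof (rule ccontr)
  assume "\<not> thesis"
  then have "P \<subseteq> span {v}" using that by blast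
  then have "dim P \<le> card {v}" by (rule dim_le_card) simp
  with assms show False by simp
qed

text \<open>The cases are told apart by whether the plane contains a timelike vector, none but a
  nonzero null vector, or neither. The frame is chosen so that the axis becomes the one for which
  the catenoid of that type is written down.\<close>

lemma plane_frame_cases:
  assumes P: "subspace P" "dim P = 2"
  obtains (lorentzian) T E2 E3 E4 where "lorentz_frame T E2 E3 E4" "T \<in> P" "E4 \<in> P"
  | (riemannian) T E2 E3 E4 where "lorentz_frame T E2 E3 E4" "E2 \<in> P" "E3 \<in> P"
  | (degenerate) T E2 E3 E4 where "lorentz_frame T E2 E3 E4" "T + E4 \<in> P" "E3 \<in> P"
proof (cases "\<exists>v\<in>P. lorentz v v < 0")
  case True
  then obtain v where v: "v \<in> P" "lorentz v v < 0" by blast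
  obtain c where c: "(c *\<^sub>R v) $ 1 > 0" "lorentz (c *\<^sub>R v) (c *\<^sub>R v) = - 1"
    using unit_timelike_exists[OF v(2)] .
  define T where "T = c *\<^sub>R v"
  have T: "T \<in> P" "T $ 1 > 0" "lorentz T T = - 1"
    using v P c by (simp_all add: T_def subspace_scale)
  obtain w where w: "w \<in> P" "w \<notin> span {T}" using second_independent_vector[OF P(2)] .
  \<comment> \<open>The projection off \<open>T\<close> has a plus sign because
    \<open>lorentz T T = - 1\<close>.\<close>
  define w' where "w' = w + lorentz w T *\<^sub>R T"
  have w'T: "lorentz w' T = 0" using T by (simp add: w'_def lorentz_simps)
  have "w' \<noteq> 0"
  proof
    assume "w' = 0"
    then have "w = (- lorentz w T) *\<^sub>R T" by (simp add: w'_def add_eq_0_iff2)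
    with w(2) show False by (metis span_base span_scale singletonI)
  qed
  with w'T T have p: "lorentz w' w' > 0" using timelike_orthogonal[of T w'] by simp
  define E4 where "E4 = (1 / sqrt (lorentz w' w')) *\<^sub>R w'"
  have "w' \<in> P" using w T P by (simp add: w'_def subspace_add subspace_scale)
  then have E4: "E4 \<in> P" "lorentz E4 E4 = 1" "lorentz E4 T = 0"
    using P p w'T by (simp_all add: E4_def lorentz_simps subspace_scale)
  obtain E3 where "lorentz E3 E3 = 1" "lorentz E3 T = 0" "lorentz E3 E4 = 0"
    using unit_spatial_exists[of T E4] T E4 by auto
  with T E4 obtain E2 where "lorentz_frame T E2 E3 E4"
    using lorentz_frame_extend_spatial by blast
  with T E4 show ?thesis using lorentzian by blast
next
  case nonneg: False
  let ?e = "axis 1 1 :: L4"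
  have e: "lorentz ?e ?e = - 1" by (simp add: lorentz_def axis_def)
  show ?thesis
  proof (cases "\<exists>v\<in>P. v \<noteq> 0 \<and> lorentz v v = 0")
    case True
    then obtain N where N: "N \<in> P" "N \<noteq> 0" "lorentz N N = 0" by blast
    obtain w where w: "w \<in> P" "w \<notin> span {N}" using second_independent_vector[OF P(2)] .
    \<comment> \<open>Otherwise the square of \<open>w + s *\<^sub>R N\<close> is affine in
      \<open>s\<close> with nonzero slope, hence equals -1 for a suitable \<open>s\<close>, and the
      plane would contain a timelike vector.\<close>
    have wN: "lorentz w N = 0"
    proof (rule ccontr)
      assume nz: "lorentz w N \<noteq> 0"
      define s where "s = - (lorentz w w + 1) / (2 * lorentz w N)"
      have "lorentz (w + s *\<^sub>R N) (w + s *\<^sub>R N) = lorentz w w + 2 * s * lorentz w N"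
        using N by (simp add: lorentz_simps lorentz_commute[of N w])
      also have "s * lorentz w N = - (lorentz w w + 1) / 2" using nz by (simp add: s_def)
      then have "lorentz w w + 2 * s * lorentz w N = - 1" by (simp add: field_simps)
      finally have "lorentz (w + s *\<^sub>R N) (w + s *\<^sub>R N) < 0" by simp
      moreover have "w + s *\<^sub>R N \<in> P" using w N P by (simp add: subspace_add subspace_scale)
      ultimately show False using nonneg by blast
    qed
    have "lorentz w w \<noteq> 0"
    proof
      assume "lorentz w w = 0"
      then obtain k where "w = k *\<^sub>R N" using null_orthogonal_parallel[of w N] N wN by blast
      with w(2) show False by (simp add: span_base span_scale)
    qed
    with nonneg w have p: "lorentz w w > 0" by (meson linorder_neqE_linordered_idom)
    define E3 where "E3 = (1 / sqrt (lorentz w w)) *\<^sub>R w"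
    have E3: "E3 \<in> P" "lorentz E3 E3 = 1" "lorentz E3 N = 0"
      using P p wN w by (simp_all add: E3_def lorentz_simps subspace_scale)
    \<comment> \<open>Removing the component along a spacelike unit vector lowers the square of the
      timelike \<open>?e\<close> further, so \<open>t\<close> is timelike. The Riemannian case does
      this twice.\<close>
    define t where "t = ?e - lorentz ?e E3 *\<^sub>R E3"
    have tE: "lorentz t E3 = 0" using E3 by (simp add: t_def lorentz_simps)
    have "lorentz t t = - 1 - (lorentz ?e E3)\<^sup>2"
      using E3 e by (simp add: t_def lorentz_simps lorentz_commute[of E3 ?e] power2_eq_square)
    then have tt: "lorentz t t < 0" by (smt (verit) zero_le_power2)
    obtain c where c: "(c *\<^sub>R t) $ 1 > 0" "lorentz (c *\<^sub>R t) (c *\<^sub>R t) = - 1"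
      using unit_timelike_exists[OF tt] .
    define T where "T = c *\<^sub>R t"
    have T: "T $ 1 > 0" "lorentz T T = - 1" "lorentz E3 T = 0"
      using c tE by (simp_all add: T_def lorentz_simps lorentz_commute[of E3])
    have NT: "lorentz N T \<noteq> 0"
      using timelike_orthogonal[of T N] N T by auto
    \<comment> \<open>The normalization \<open>lorentz M T = - 1\<close> is what makes
      \<open>M - T\<close> a unit vector orthogonal to \<open>T\<close>, so that the null direction
      of the plane becomes \<open>T + E4\<close>.\<close>
    define M where "M = (- 1 / lorentz N T) *\<^sub>R N"
    have M: "M \<in> P" "lorentz M M = 0" "lorentz M T = - 1" "lorentz M E3 = 0"
      using N P NT E3 by (simp_all add: M_def subspace_scale lorentz_simps lorentz_commute[of N E3] subspace_neg)
    define E4 where "E4 = M - T"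
    have E4: "lorentz E4 E4 = 1" "lorentz E4 T = 0" "lorentz E3 E4 = 0" "T + E4 \<in> P"
      using M T by (simp_all add: E4_def lorentz_simps lorentz_commute[of T M] lorentz_commute[of E3 M])
    obtain E2 where "lorentz_frame T E2 E3 E4"
      using lorentz_frame_extend_spatial[of T E3 E4] T E3 E4 by blast
    with E3 E4 show ?thesis using degenerate by blast
  next
    case False
    then have pos: "lorentz v v > 0" if "v \<in> P" "v \<noteq> 0" for v
      using nonneg that by (meson linorder_neqE_linordered_idom)
    \<comment> \<open>Being outside the span of 0 just means being nonzero.\<close>
    obtain v where v: "v \<in> P" "v \<notin> span {0}" using second_independent_vector[OF P(2)] .
    then have pv: "lorentz v v > 0" using pos by (simp add: span_0 split: if_splits) 
    define E2 where "E2 = (1 / sqrt (lorentz v v)) *\<^sub>R v"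
    have E2: "E2 \<in> P" "lorentz E2 E2 = 1"
      using P v pv by (simp_all add: E2_def lorentz_simps subspace_scale)
    obtain w where w: "w \<in> P" "w \<notin> span {E2}" using second_independent_vector[OF P(2)] .
    define w' where "w' = w - lorentz w E2 *\<^sub>R E2"
    have w': "lorentz w' E2 = 0" "w' \<in> P"
      using E2 P w by (simp_all add: w'_def lorentz_simps subspace_diff subspace_scale)
    have "w' \<noteq> 0"
    proof
      assume "w' = 0"
      then have "w = lorentz w E2 *\<^sub>R E2" by (simp add: w'_def)
      with w(2) show False by (metis span_base span_scale singletonI)
    qed
    then have pw: "lorentz w' w' > 0" using pos w' by blast
    define E3 where "E3 = (1 / sqrt (lorentz w' w')) *\<^sub>R w'"
    have E3: "E3 \<in> P" "lorentz E3 E3 = 1" "lorentz E3 E2 = 0"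
      using P w' pw by (simp_all add: E3_def lorentz_simps subspace_scale)
    define t where "t = ?e - lorentz ?e E2 *\<^sub>R E2 - lorentz ?e E3 *\<^sub>R E3"
    have tE: "lorentz t E2 = 0" "lorentz t E3 = 0"
      using E2 E3 by (simp_all add: t_def lorentz_simps lorentz_commute[of E2 E3])
    have "lorentz t t = - 1 - (lorentz ?e E2)\<^sup>2 - (lorentz ?e E3)\<^sup>2"
      using E2 E3 e by (simp add: t_def lorentz_simps lorentz_commute[of E3 ?e] lorentz_commute[of E2 ?e]
          lorentz_commute[of E2 E3] power2_eq_square)
    then have tt: "lorentz t t < 0" by (smt (verit) zero_le_power2)
    obtain c where c: "(c *\<^sub>R t) $ 1 > 0" "lorentz (c *\<^sub>R t) (c *\<^sub>R t) = - 1"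
      using unit_timelike_exists[OF tt] .
    define T where "T = c *\<^sub>R t"
    have T: "T $ 1 > 0" "lorentz T T = - 1" "lorentz E2 T = 0" "lorentz E3 T = 0"
      using c tE by (simp_all add: T_def lorentz_simps lorentz_commute[of E3] lorentz_commute[of E2])
    obtain E4 where E4: "lorentz_frame T E4 E2 E3"
      using lorentz_frame_extend_spatial[of T E2 E3] T E2 E3 lorentz_commute[of E2 E3] by auto
    then have "lorentz_frame T E2 E3 E4"
      by (simp add: lorentz_frame_def lorentz_commute)
    with E2 E3 show ?thesis using riemannian by blast
  qed
qed

section \<open>Zero mean curvature and harmonic functions\<close>

lemma lorentz_eqI:
  assumes "\<And>v. lorentz a v = lorentz b v"
  shows "a = b"
proof -
  have "lorentz (a - b) (axis i 1) = 0" for i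
    using assms by (simp add: lorentz_simps)
  from this[of 1] this[of 2] this[of 3] this[of 4] show ?thesis
    by (simp add: lorentz_def axis_def vec_eq_iff forall_4)
qed

lemma partials_locally_constant:
  assumes "partials f a b w" "open D" "w \<in> D" "\<And>z. z \<in> D \<Longrightarrow> f z = c"
  shows "a = 0" "b = 0"
  using partials_unique[OF assms(1) partials_transfer[OF partials_const assms(2,3)], of c] assms(4)
  by simp_all

text \<open>The Cauchy-Riemann equations of \<open>hu - \<i> * hv\<close> are harmonicity and
  equality of the mixed derivatives, the latter encoded by the shared \<open>huv\<close>. No
  primitive is mentioned, so it may be multivalued, and the values are complex, so that it may be a
  complex logarithm.\<close>

lemma gradient_holomorphic:
  assumes "open D"
    and u: "\<And>w. w \<in> D \<Longrightarrow> partials hu (huu w) (huv w) w"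
    and v: "\<And>w. w \<in> D \<Longrightarrow> partials hv (huv w) (hvv w) w"
    and harmonic: "\<And>w. w \<in> D \<Longrightarrow> huu w + hvv w = 0"
  shows "(\<lambda>w. hu w - \<i> * hv w) holomorphic_on D"
proof -
  have "((\<lambda>w. hu w - \<i> * hv w) has_field_derivative (huu w - \<i> * huv w)) (at w)" if w: "w \<in> D" for w
  proof (rule partials_field_derivative)
    have p: "partials (\<lambda>w. hu w - \<i> * hv w) (huu w - \<i> * huv w) (huv w - \<i> * hvv w) w"
      using partials_diff[OF u[OF w] partials_mult[OF partials_const[of \<i>] v[OF w]]] by simp
    have "huv w - \<i> * hvv w = \<i> * (huu w - \<i> * huv w)"
      using harmonic[OF w] by (simp add: algebra_simps add_eq_0_iff)
    with p show "partials (\<lambda>w. hu w - \<i> * hv w) (huu w - \<i> * huv w) (\<i> * (huu w - \<i> * huv w)) w"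
      by simp
  qed
  with assms(1) show ?thesis by (auto simp: holomorphic_on_open)
qed

text \<open>The last hypothesis is the Laplace equation of \<open>log g\<close> cleared of
  denominators, with bilinear squares rather than moduli. Only the logarithmic derivatives of
  \<open>g\<close> occur, so no branch of the logarithm is chosen.\<close>

lemma log_gradient_holomorphic:
  assumes "open D"
    and g: "\<And>w. w \<in> D \<Longrightarrow> partials g (gu w) (gv w) w" "\<And>w. w \<in> D \<Longrightarrow> g w \<noteq> 0"
    and u: "\<And>w. w \<in> D \<Longrightarrow> partials gu (guu w) (guv w) w"
    and v: "\<And>w. w \<in> D \<Longrightarrow> partials gv (guv w) (gvv w) w"
    and log_harmonic: "\<And>w. w \<in> D \<Longrightarrow> g w * (guu w + gvv w) = gu w * gu w + gv w * gv w"
  shows "(\<lambda>w. gu w / g w - \<i> * (gv w / g w)) holomorphic_on D"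
proof (rule gradient_holomorphic[OF assms(1)])
  fix w assume w: "w \<in> D"
  show "partials (\<lambda>w. gu w / g w) ((guu w * g w - gu w * gu w) / (g w)\<^sup>2)
      ((guv w * g w - gu w * gv w) / (g w)\<^sup>2) w"
    using partials_divide[OF u[OF w] g(1)[OF w] g(2)[OF w]] .
  show "partials (\<lambda>w. gv w / g w) ((guv w * g w - gu w * gv w) / (g w)\<^sup>2)
      ((gvv w * g w - gv w * gv w) / (g w)\<^sup>2) w"
    using partials_divide[OF v[OF w] g(1)[OF w] g(2)[OF w]] by (simp add: mult.commute)
  show "(guu w * g w - gu w * gu w) / (g w)\<^sup>2 + (gvv w * g w - gv w * gv w) / (g w)\<^sup>2 = 0"
    using log_harmonic[OF w] by (simp add: add_divide_distrib[symmetric] algebra_simps)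
qed

text \<open>Otherwise the image would have interior points, while a differentiable curve is negligible.\<close>

lemma jacobian_zero_of_image_in_curve:
  fixes f g :: "complex \<Rightarrow> real" and c :: "real \<Rightarrow> complex"
  assumes D: "open D" and f: "\<And>w. w \<in> D \<Longrightarrow> partials f (fu w) (fv w) w"
    and g: "\<And>w. w \<in> D \<Longrightarrow> partials g (gu w) (gv w) w"
    and c: "c differentiable_on I" and sub: "\<And>w. w \<in> D \<Longrightarrow> Complex (f w) (g w) \<in> c ` I"
    and w: "w \<in> D"
  shows "fu w * gv w = fv w * gu w"
proof (rule ccontr)
  assume nz: "fu w * gv w \<noteq> fv w * gu w"
  define \<Delta> where "\<Delta> = fu w * gv w - fv w * gu w"
  have \<Delta>: "\<Delta> \<noteq> 0" using nz by (simp add: \<Delta>_def)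
  let ?F = "\<lambda>z. of_real (f z) + \<i> * of_real (g z)"
  have F: "partials ?F (of_real (fu z) + \<i> * of_real (gu z)) (of_real (fv z) + \<i> * of_real (gv z)) z"
    if "z \<in> D" for z
    using partials_add[OF partials_of_real[OF f[OF that]]
        partials_mult[OF partials_const[of \<i>] partials_of_real[OF g[OF that]]]] by simp
  let ?G = "\<lambda>k. Complex ((gv w * Re k - fv w * Im k) / \<Delta>) ((fu w * Im k - gu w * Re k) / \<Delta>)"
  have "?F w \<in> interior (?F ` D)"
  proof (rule sussmann_open_mapping[OF D _ w F[OF w, unfolded partials_def]])
    show "continuous_on D ?F"
    proof (intro continuous_at_imp_continuous_on ballI)
      fix z assume "z \<in> D"
      then show "isCont ?F z"
        by (intro differentiable_imp_continuous_within partials_differentiable[OF F])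
    qed
    have "linear ?G"
      by (rule linearI) (simp_all add: complex_eq_iff algebra_simps add_divide_distrib diff_divide_distrib)
    then show "bounded_linear ?G" by (simp add: linear_linear)
    show "(\<lambda>h. Re h *\<^sub>R (of_real (fu w) + \<i> * of_real (gu w)) +
        Im h *\<^sub>R (of_real (fv w) + \<i> * of_real (gv w))) \<circ> ?G = id"
    proof
      fix k
      have "gv w * Re k * fu w - fv w * Im k * fu w + (fu w * Im k * fv w - gu w * Re k * fv w) = \<Delta> * Re k"
        "gv w * Re k * gu w - fv w * Im k * gu w + (fu w * Im k * gv w - gu w * Re k * gv w) = \<Delta> * Im k"
        by (simp_all add: \<Delta>_def algebra_simps)
      then show "((\<lambda>h. Re h *\<^sub>R (of_real (fu w) + \<i> * of_real (gu w)) +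
        Im h *\<^sub>R (of_real (fv w) + \<i> * of_real (gv w))) \<circ> ?G) k = id k"
        using \<Delta> by (simp add: complex_eq_iff add_divide_distrib[symmetric] left_diff_distrib)
    qed
    show "w \<in> interior D" using D w by (simp add: interior_open)
  qed simp
  moreover have "negligible (c ` I)"
    by (rule negligible_differentiable_image_lowdim[OF _ c]) simp
  then have "negligible (?F ` D)"
    by (rule negligible_subset) (use sub in \<open>auto simp: Complex_eq\<close>)
  then have "negligible (interior (?F ` D))"
    using interior_subset negligible_subset by blast
  ultimately show False using open_not_negligible[OF open_interior] by blast
qed

section \<open>Local geometry of a zero mean curvature immersion\<close>

locale zmc_immersion =
  fixes D :: "complex set" and X :: "complex \<Rightarrow> L4" and \<phi> :: "complex \<Rightarrow> real"
  assumes open_D: "open D" and connected_D: "connected D" and nonempty_D: "D \<noteq> {}"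
    and immersion: "conformal_spacelike_immersion D X \<phi>"
    and zmc: "\<And>w. w \<in> D \<Longrightarrow> mean_curvature X \<phi> w = 0"
begin

definition lap :: "complex \<Rightarrow> L4" where "lap w = du (du X) w + dv (dv X) w"

lemma smooth: "smooth_on X D"
  using immersion by (simp add: conformal_spacelike_immersion_def)

lemmas partials_X = smooth_on_partials(3)[OF smooth]
lemmas partials_du = smooth_on_partials(3)[OF smooth_on_partials(1)[OF smooth]]
lemmas partials_dv = smooth_on_partials(3)[OF smooth_on_partials(2)[OF smooth]]
lemmas partials_du_du = smooth_on_partials(3)[OF smooth_on_partials(1)[OF smooth_on_partials(1)[OF smooth]]]
lemmas partials_dv_dv = smooth_on_partials(3)[OF smooth_on_partials(2)[OF smooth_on_partials(2)[OF smooth]]]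

lemma mixed_partials: "w \<in> D \<Longrightarrow> du (dv X) w = dv (du X) w"
  using partials_symmetric[OF open_D _ partials_X partials_du partials_dv] by simp

lemma
  assumes w: "w \<in> D"
  shows in_cone: "X w \<in> light_cone"
    and gram_XX: "lorentz (X w) (X w) = 0"
    and gram_UU: "lorentz (du X w) (du X w) = (\<phi> w)\<^sup>2"
    and gram_VV: "lorentz (dv X w) (dv X w) = (\<phi> w)\<^sup>2"
    and gram_UV: "lorentz (du X w) (dv X w) = 0"
    and \<phi>_pos: "\<phi> w > 0"
  using immersion w by (auto simp: conformal_spacelike_immersion_def light_cone_iff)

lemma
  assumes w: "w \<in> D"
  shows gram_UX: "lorentz (du X w) (X w) = 0" and gram_VX: "lorentz (dv X w) (X w) = 0"
  using partials_locally_constant[OF partials_lorentz[OF partials_X[OF w] partials_X[OF w]] open_D w gram_XX]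
  by (simp_all add: lorentz_commute[of "X w"])

lemma lap_gram:
  assumes w: "w \<in> D"
  shows "lorentz (lap w) (X w) = - 2 * (\<phi> w)\<^sup>2"
    and "lorentz (lap w) (du X w) = 0" and "lorentz (lap w) (dv X w) = 0"
proof -
  note c = lorentz_commute[of "du X w"] lorentz_commute[of "dv X w"]
  have "lorentz (du (du X) w) (X w) + lorentz (du X w) (du X w) = 0"
    by (rule partials_locally_constant(1)[OF partials_lorentz[OF partials_du[OF w] partials_X[OF w]] open_D w gram_UX])
  moreover have "lorentz (dv (dv X) w) (X w) + lorentz (dv X w) (dv X w) = 0"
    by (rule partials_locally_constant(2)[OF partials_lorentz[OF partials_dv[OF w] partials_X[OF w]] open_D w gram_VX])
  ultimately show "lorentz (lap w) (X w) = - 2 * (\<phi> w)\<^sup>2"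
    using gram_UU[OF w] gram_VV[OF w] by (simp add: lap_def lorentz_simps)
  \<comment> \<open>In conformal coordinates the Laplacian of \<open>X\<close> has no tangential
    part: half of a derivative of the difference of the two squared lengths combines with the other
    derivative of \<open>\<langle>X_u, X_v\<rangle> = 0\<close>, the mixed terms cancelling.\<close>
  have "lorentz (du X z) (du X z) - lorentz (dv X z) (dv X z) = 0" if "z \<in> D" for z
    using gram_UU[OF that] gram_VV[OF that] by simp
  note 1 = partials_locally_constant[OF partials_diff[OF partials_lorentz[OF partials_du[OF w] partials_du[OF w]]
        partials_lorentz[OF partials_dv[OF w] partials_dv[OF w]]] open_D w this]
  note 2 = partials_locally_constant[OF partials_lorentz[OF partials_du[OF w] partials_dv[OF w]] open_D w gram_UV]
  show "lorentz (lap w) (du X w) = 0" "lorentz (lap w) (dv X w) = 0"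
    using 1 2 mixed_partials[OF w] by (simp_all add: lap_def lorentz_simps c)
qed

text \<open>Whether or not the mean curvature vanishes, the rescaled Laplacian of \<open>X\<close> differs from the Gauss map
  only by a multiple of \<open>X\<close>, determined by nullity.\<close>

definition normal0 :: "complex \<Rightarrow> L4" where
  "normal0 w = (- 1 / (2 * lorentz (du X w) (du X w))) *\<^sub>R lap w"

definition normal :: "complex \<Rightarrow> L4" where
  "normal w = normal0 w - (lorentz (normal0 w) (normal0 w) / 2) *\<^sub>R X w"

lemma normal_gram:
  assumes w: "w \<in> D"
  shows "lorentz (normal w) (normal w) = 0" "lorentz (normal w) (du X w) = 0"
    "lorentz (normal w) (dv X w) = 0" "lorentz (normal w) (X w) = 1"
proof -
  have Y: "lorentz (normal0 w) (X w) = 1" "lorentz (normal0 w) (du X w) = 0" "lorentz (normal0 w) (dv X w) = 0"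
    using \<phi>_pos[OF w] by (simp_all add: normal0_def lorentz_simps lap_gram[OF w] gram_UU[OF w])
  show "lorentz (normal w) (normal w) = 0" "lorentz (normal w) (du X w) = 0"
    "lorentz (normal w) (dv X w) = 0" "lorentz (normal w) (X w) = 1"
    using Y gram_XX[OF w] gram_UX[OF w] gram_VX[OF w]
    by (simp_all add: normal_def lorentz_simps lorentz_commute[of "X w" "normal0 w"]
        lorentz_commute[of "X w" "du X w"] lorentz_commute[of "X w" "dv X w"])
qed

lemma gauss_map_eq:
  assumes w: "w \<in> D"
  shows "gauss_map X w = normal w"
  unfolding gauss_map_def
proof (rule the_equality)
  show "lorentz (normal w) (normal w) = 0 \<and> lorentz (normal w) (du X w) = 0 \<and>
      lorentz (normal w) (dv X w) = 0 \<and> lorentz (normal w) (X w) = 1"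
    using normal_gram[OF w] by simp
next
  fix m assume m: "lorentz m m = 0 \<and> lorentz m (du X w) = 0 \<and> lorentz m (dv X w) = 0 \<and> lorentz m (X w) = 1"
  have G: "lorentz m v = lorentz m (normal w) * lorentz v (X w) + lorentz v (normal w)" for v
    using null_frame_gram[OF gram_XX[OF w] normal_gram(1,4)[OF w] gram_UU[OF w] gram_VV[OF w] gram_UV[OF w]
        gram_UX[OF w] gram_VX[OF w] normal_gram(2,3)[OF w], of m v] m \<phi>_pos[OF w] by simp
  \<comment> \<open>Nullity of \<open>m\<close> turns the expansion at \<open>v = m\<close> into
    \<open>2 * lorentz m (normal w) = 0\<close>; after that it says that \<open>m\<close> and
    \<open>normal w\<close> have the same pairing with every vector.\<close>
  from G[of m] m have "lorentz m (normal w) = 0" by simp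
  with G show "m = normal w" by (intro lorentz_eqI) (simp add: lorentz_commute)
qed

text \<open>The mean curvature is formed with \<open>frechet_derivative\<close> of the Gauss map,
  which carries information only once differentiability is known. The explicit formula provides it,
  through third derivatives of \<open>X\<close>.\<close>

lemma normal_partials:
  assumes w: "w \<in> D"
  obtains a b where "partials normal a b w"
proof -
  have 1: "\<exists>a b. partials lap a b w"
    unfolding lap_def[abs_def] using partials_add[OF partials_du_du[OF w] partials_dv_dv[OF w]] by blast
  \<comment> \<open>The conformal factor enters as the square of \<open>X_u\<close>, because
    \<open>\<phi>\<close> itself is not given as a differentiable function.\<close>
  have "lorentz (du X w) (du X w) \<noteq> 0" using gram_UU[OF w] \<phi>_pos[OF w] by simp
  then have 2: "\<exists>a b. partials (\<lambda>w. - 1 / (2 * lorentz (du X w) (du X w))) a b w"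
    using partials_divide[OF partials_const[of "-1 :: real"]
        partials_mult[OF partials_const[of "2 :: real"] partials_lorentz[OF partials_du[OF w] partials_du[OF w]]]]
    by auto
  from 1 2 have 3: "\<exists>a b. partials normal0 a b w"
    unfolding normal0_def[abs_def] using partials_scaleR by blast
  then have "\<exists>a b. partials (\<lambda>w. lorentz (normal0 w) (normal0 w) / 2) a b w"
    using partials_divide[OF partials_lorentz partials_const[of "2 :: real"]] by fastforce
  then have "\<exists>a b. partials (\<lambda>w. (lorentz (normal0 w) (normal0 w) / 2) *\<^sub>R X w) a b w"
    using partials_scaleR[OF _ partials_X[OF w]] by blast
  with 3 have "\<exists>a b. partials normal a b w"
    unfolding normal_def[abs_def] using partials_diff by blast
  then show ?thesis using that by blast
qed

text \<open>Differentiating the orthogonality of the Gauss map to \<open>X_u\<close> and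
  \<open>X_v\<close> moves the derivative onto \<open>X\<close>, so zero mean curvature says that
  the Laplacian is orthogonal to the Gauss map. This makes \<open>normal0\<close> null, and the
  correction along \<open>X\<close> disappears.\<close>

lemma lap_eq:
  assumes w: "w \<in> D"
  shows "lap w = (- 2 * (\<phi> w)\<^sup>2) *\<^sub>R normal w"
proof -
  obtain a b where n: "partials normal a b w" using normal_partials[OF w] .
  have "partials (gauss_map X) a b w"
    by (rule partials_transfer[OF n open_D w]) (simp add: gauss_map_eq)
  then have "lorentz (du X w) a + lorentz (dv X w) b = 0"
    using zmc[OF w] \<phi>_pos[OF w] by (simp add: mean_curvature_def partials_du_dv)
  moreover have "lorentz a (du X w) + lorentz (normal w) (du (du X) w) = 0"
    by (rule partials_locally_constant(1)[OF partials_lorentz[OF n partials_du[OF w]] open_D w normal_gram(2)])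
  moreover have "lorentz b (dv X w) + lorentz (normal w) (dv (dv X) w) = 0"
    by (rule partials_locally_constant(2)[OF partials_lorentz[OF n partials_dv[OF w]] open_D w normal_gram(3)])
  ultimately have nl: "lorentz (normal w) (lap w) = 0"
    by (simp add: lap_def lorentz_simps lorentz_commute[of "du X w"] lorentz_commute[of "dv X w"])
  have lap: "lap w = (- 2 * (\<phi> w)\<^sup>2) *\<^sub>R normal0 w"
    using \<phi>_pos[OF w] by (simp add: normal0_def gram_UU[OF w])
  have "lorentz (normal0 w) (X w) = 1"
    using \<phi>_pos[OF w] by (simp add: normal0_def lorentz_simps lap_gram[OF w] gram_UU[OF w])
  \<comment> \<open>With \<open>c\<close> this square, \<open>lorentz (normal w) (normal0 w)\<close>
    equals \<open>c - c / 2\<close>, which has just been seen to vanish.\<close>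
  then have "lorentz (normal0 w) (normal0 w) = 0"
    using nl \<phi>_pos[OF w] by (simp add: lap lorentz_simps normal_def lorentz_commute[of "X w" "normal0 w"])
  then show ?thesis using lap by (simp add: normal_def)
qed

text \<open>For \<open>M = N\<close> null this says that \<open>ln \<bar>lorentz (X w) N\<bar>\<close> is harmonic.\<close>

lemma laplace_identity:
  assumes w: "w \<in> D"
  shows "lorentz (X w) N * lorentz (lap w) M + lorentz (X w) M * lorentz (lap w) N
    - 2 * (lorentz (du X w) N * lorentz (du X w) M + lorentz (dv X w) N * lorentz (dv X w) M)
    = - 2 * (\<phi> w)\<^sup>2 * lorentz N M"
proof -
  have aux: "s * (a + b / s) = s * a + b" if "s \<noteq> 0" for s a b :: real
    using that by (simp add: distrib_left)
  have "(\<phi> w)\<^sup>2 * lorentz N M = (\<phi> w)\<^sup>2 * (lorentz N (normal w) * lorentz M (X w) + lorentz N (X w) * lorentz M (normal w))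
      + (lorentz N (du X w) * lorentz M (du X w) + lorentz N (dv X w) * lorentz M (dv X w))"
    using null_frame_gram[OF gram_XX[OF w] normal_gram(1,4)[OF w] gram_UU[OF w] gram_VV[OF w] gram_UV[OF w]
        gram_UX[OF w] gram_VX[OF w] normal_gram(2,3)[OF w], of N M]
      aux[of "(\<phi> w)\<^sup>2"] \<phi>_pos[OF w] by simp
  then show ?thesis
    by (simp add: lap_eq[OF w] lorentz_simps lorentz_commute[of N "X w"] lorentz_commute[of M "X w"]
        lorentz_commute[of N "normal w"] lorentz_commute[of M "normal w"] lorentz_commute[of N "du X w"]
        lorentz_commute[of M "du X w"] lorentz_commute[of N "dv X w"] lorentz_commute[of M "dv X w"] algebra_simps)
qed

lemma
  assumes "w \<in> D"
  shows partials_coord: "partials (\<lambda>z. lorentz (X z) N) (lorentz (du X w) N) (lorentz (dv X w) N) w"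
    and partials_coord_u: "partials (\<lambda>z. lorentz (du X z) N) (lorentz (du (du X) w) N) (lorentz (dv (du X) w) N) w"
    and partials_coord_v: "partials (\<lambda>z. lorentz (dv X z) N) (lorentz (dv (du X) w) N) (lorentz (dv (dv X) w) N) w"
  using partials_lorentz_const[OF partials_X[OF assms]] partials_lorentz_const[OF partials_du[OF assms]]
    partials_lorentz_const[OF partials_dv[OF assms]] mixed_partials[OF assms] by simp_all

lemma null_coord_log_gradient:
  assumes N: "lorentz N N = 0" and nz: "\<And>w. w \<in> D \<Longrightarrow> lorentz (X w) N \<noteq> 0"
  shows "(\<lambda>w. Complex (lorentz (du X w) N / lorentz (X w) N) (- (lorentz (dv X w) N / lorentz (X w) N)))
    holomorphic_on D"
proof -
  have "(\<lambda>w. of_real (lorentz (du X w) N) / of_real (lorentz (X w) N)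
      - \<i> * (of_real (lorentz (dv X w) N) / of_real (lorentz (X w) N))) holomorphic_on D"
  proof (rule log_gradient_holomorphic[OF open_D partials_of_real[OF partials_coord] _
        partials_of_real[OF partials_coord_u] partials_of_real[OF partials_coord_v]])
    fix w assume w: "w \<in> D"
    have "lorentz (X w) N * (lorentz (du (du X) w) N + lorentz (dv (dv X) w) N)
        = lorentz (du X w) N * lorentz (du X w) N + lorentz (dv X w) N * lorentz (dv X w) N"
      using laplace_identity[OF w, of N N] N by (simp add: lap_def lorentz_simps)
    then show "complex_of_real (lorentz (X w) N) * (of_real (lorentz (du (du X) w) N) + of_real (lorentz (dv (dv X) w) N))
        = of_real (lorentz (du X w) N) * of_real (lorentz (du X w) N)
          + of_real (lorentz (dv X w) N) * of_real (lorentz (dv X w) N)"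
      by (metis of_real_add of_real_mult)
  qed (use nz in auto)
  then show ?thesis
    by (rule holomorphic_transform) (simp add: complex_eq_iff)
qed

end

lemma Im_mult_cnj_Complex: "Im (Complex a b * cnj (Complex c d)) = b * c - a * d"
  by simp

section \<open>Affine relations between the harmonic functions of the axis coordinates\<close>

context zmc_immersion
begin

text \<open>In the next three lemmas the hypothesis \<open>jac\<close> holds because the two coordinates together map \<open>D\<close> into a
  curve.\<close>

lemma lorentzian_axis_relation:
  assumes N: "lorentz N N = 0" "lorentz M M = 0" "lorentz N M \<noteq> 0"
    and neg: "\<And>w. w \<in> D \<Longrightarrow> lorentz (X w) N < 0" "\<And>w. w \<in> D \<Longrightarrow> lorentz (X w) M < 0"
    and jac: "\<And>w. w \<in> D \<Longrightarrow>
      lorentz (du X w) N * lorentz (dv X w) M = lorentz (dv X w) N * lorentz (du X w) M"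
  obtains l k where "\<And>w. w \<in> D \<Longrightarrow> ln (- lorentz (X w) N) + ln (- lorentz (X w) M) =
      l * (ln (- lorentz (X w) M) - ln (- lorentz (X w) N)) + k"
proof -
  define aN where "aN w = lorentz (du X w) N / lorentz (X w) N" for w
  define bN where "bN w = lorentz (dv X w) N / lorentz (X w) N" for w
  define aM where "aM w = lorentz (du X w) M / lorentz (X w) M" for w
  define bM where "bM w = lorentz (dv X w) M / lorentz (X w) M" for w
  \<comment> \<open>Sum and difference are taken because a single logarithm can be constant: on the
    elliptic catenoid this happens for \<open>a = 2\<close> and \<open>a = -2\<close>, whereas the
    difference there is \<open>4 * v\<close>.\<close>
  define p where "p w = Complex (aN w + aM w) (- (bN w + bM w))" for w
  define q where "q w = Complex (aM w - aN w) (- (bM w - bN w))" for w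
  have nz: "lorentz (X w) N \<noteq> 0" "lorentz (X w) M \<noteq> 0" if "w \<in> D" for w
    using neg[OF that] by simp_all
  have hN: "(\<lambda>w. Complex (aN w) (- bN w)) holomorphic_on D"
    unfolding aN_def bN_def by (rule null_coord_log_gradient[OF N(1) nz(1)])
  have hM: "(\<lambda>w. Complex (aM w) (- bM w)) holomorphic_on D"
    unfolding aM_def bM_def by (rule null_coord_log_gradient[OF N(2) nz(2)])
  have hp: "p holomorphic_on D"
    by (rule holomorphic_transform[OF holomorphic_on_add[OF hN hM]]) (simp add: p_def complex_eq_iff)
  have hq: "q holomorphic_on D"
    by (rule holomorphic_transform[OF holomorphic_on_diff[OF hM hN]]) (simp add: q_def complex_eq_iff)
  have q0: "q w \<noteq> 0" if w: "w \<in> D" for w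
  proof
    assume "q w = 0"
    then have e: "aM w = aN w" "bM w = bN w" by (simp_all add: q_def complex_eq_iff)
    let ?f = "lorentz (X w) N" and ?g = "lorentz (X w) M"
    have d: "lorentz (du X w) N = aN w * ?f" "lorentz (dv X w) N = bN w * ?f"
      "lorentz (du X w) M = aN w * ?g" "lorentz (dv X w) M = bN w * ?g"
      using nz[OF w] e unfolding aN_def bN_def aM_def bM_def by (simp_all add: field_simps)
    \<comment> \<open>If both logarithmic gradients agree, nullity of \<open>N\<close> and of
      \<open>M\<close> makes both coordinates satisfy the same equation with factor
      \<open>c\<close>. In the mixed identity everything then cancels except the metric term, which
      is nonzero.\<close>
    define c where "c = (aN w)\<^sup>2 + (bN w)\<^sup>2"
    have "?f * (lorentz (lap w) N - c * ?f) = 0" "?g * (lorentz (lap w) M - c * ?g) = 0"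
      using laplace_identity[OF w, of N N] laplace_identity[OF w, of M M] N
      by (simp_all add: d c_def power2_eq_square algebra_simps)
    then have "lorentz (lap w) N = c * ?f" "lorentz (lap w) M = c * ?g"
      using nz[OF w] by simp_all
    then have "- 2 * (\<phi> w)\<^sup>2 * lorentz N M = 0"
      using laplace_identity[OF w, of N M] by (simp add: d c_def power2_eq_square algebra_simps)
    then show False using N(3) \<phi>_pos[OF w] by simp
  qed
  have "Im (p w * cnj (q w)) = 0" if w: "w \<in> D" for w
  proof -
    have "aN w * bM w = bN w * aM w"
      using jac[OF w] by (simp add: aN_def bN_def aM_def bM_def)
    then show ?thesis unfolding p_def q_def Im_mult_cnj_Complex by (simp add: algebra_simps)
  qed
  with proportional_gradients[OF open_D connected_D nonempty_D hp hq q0]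
  obtain l :: real where l: "\<And>w. w \<in> D \<Longrightarrow> p w = of_real l * q w" by blast
  let ?A = "\<lambda>w. ln (- lorentz (X w) N)" and ?B = "\<lambda>w. ln (- lorentz (X w) M)"
  let ?h = "\<lambda>w. ?A w + ?B w - l * (?B w - ?A w)"
  have h: "partials ?h 0 0 w" if w: "w \<in> D" for w
  proof -
    have A: "partials ?A (aN w) (bN w) w" and B: "partials ?B (aM w) (bM w) w"
      using partials_ln[OF partials_diff[OF partials_const[of 0] partials_coord[OF w]], of N]
        partials_ln[OF partials_diff[OF partials_const[of 0] partials_coord[OF w]], of M] neg[OF w]
      by (simp_all add: aN_def bN_def aM_def bM_def)
    have "aN w + aM w = l * (aM w - aN w)" "bN w + bM w = l * (bM w - bN w)"
      using l[OF w] by (simp_all add: p_def q_def complex_eq_iff algebra_simps)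
    then show ?thesis
      using partials_diff[OF partials_add[OF A B] partials_mult[OF partials_const[of l] partials_diff[OF B A]]]
      by simp
  qed
  obtain w0 where w0: "w0 \<in> D" using nonempty_D by blast
  have "?h w = ?h w0" if "w \<in> D" for w
    by (rule partials_constant[OF open_D connected_D h that w0])
  then show ?thesis by (intro that[of l "?h w0"]) (simp add: algebra_simps)
qed

text \<open>The conclusion is a logarithmic spiral, or a circle for \<open>l = 0\<close>, in the
  plane of the two axis coordinates: the logarithm of the modulus is \<open>k + l * \<theta>\<close>
  for some argument \<open>\<theta>\<close>. The exponential form leaves the choice of
  \<open>\<theta>\<close> to each point.\<close>

lemma riemannian_axis_relation:
  assumes E: "lorentz E E = 1" "lorentz F F = 1" "lorentz E F = 0"
    and jac: "\<And>w. w \<in> D \<Longrightarrow>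
      lorentz (du X w) E * lorentz (dv X w) F = lorentz (dv X w) E * lorentz (du X w) F"
  obtains l k :: real where "\<And>w. w \<in> D \<Longrightarrow>
      \<exists>\<theta>::real. Complex (lorentz (X w) E) (lorentz (X w) F) = exp (of_real k + Complex l 1 * of_real \<theta>)"
proof -
  define x where "x w = lorentz (X w) E" for w
  define y where "y w = lorentz (X w) F" for w
  define xu where "xu w = lorentz (du X w) E" for w
  define xv where "xv w = lorentz (dv X w) E" for w
  define yu where "yu w = lorentz (du X w) F" for w
  define yv where "yv w = lorentz (dv X w) F" for w
  define xuu where "xuu w = lorentz (du (du X) w) E" for w
  define xuv where "xuv w = lorentz (dv (du X) w) E" for w
  define xvv where "xvv w = lorentz (dv (dv X) w) E" for w
  define yuu where "yuu w = lorentz (du (du X) w) F" for w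
  define yuv where "yuv w = lorentz (dv (du X) w) F" for w
  define yvv where "yvv w = lorentz (dv (dv X) w) F" for w
  define m where "m w = (x w)\<^sup>2 + (y w)\<^sup>2" for w
  note d = x_def y_def xu_def xv_def yu_def yv_def xuu_def xuv_def xvv_def yuu_def yuv_def yvv_def
  have px: "partials x (xu w) (xv w) w" "partials xu (xuu w) (xuv w) w" "partials xv (xuv w) (xvv w) w"
    and py: "partials y (yu w) (yv w) w" "partials yu (yuu w) (yuv w) w" "partials yv (yuv w) (yvv w) w"
    if "w \<in> D" for w
    using partials_coord[OF that] partials_coord_u[OF that] partials_coord_v[OF that]
    by (simp_all add: d[abs_def])
  have j: "xu w * yv w = xv w * yu w" if "w \<in> D" for w
    using jac[OF that] by (simp add: d)
  have L: "x w * (xuu w + xvv w) = (xu w)\<^sup>2 + (xv w)\<^sup>2 - (\<phi> w)\<^sup>2"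
    "y w * (yuu w + yvv w) = (yu w)\<^sup>2 + (yv w)\<^sup>2 - (\<phi> w)\<^sup>2"
    "x w * (yuu w + yvv w) + y w * (xuu w + xvv w) = 2 * (xu w * yu w + xv w * yv w)" if w: "w \<in> D" for w
    using laplace_identity[OF w, of E E] laplace_identity[OF w, of F F] laplace_identity[OF w, of E F] E
    by (simp_all add: d lap_def lorentz_simps power2_eq_square)
  have m: "m w > 0" if w: "w \<in> D" for w
  proof (rule ccontr)
    assume "\<not> m w > 0"
    then have z: "x w = 0" "y w = 0" by (simp_all add: m_def not_less sum_power2_le_zero_iff)
    \<comment> \<open>At a common zero the gradients would be orthogonal of length
      \<open>\<phi> w\<close>, hence independent by the Lagrange identity, contrary to
      \<open>jac\<close>.\<close>
    have a: "(xu w)\<^sup>2 + (xv w)\<^sup>2 = (\<phi> w)\<^sup>2" "(yu w)\<^sup>2 + (yv w)\<^sup>2 = (\<phi> w)\<^sup>2" "xu w * yu w + xv w * yv w = 0"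
      using L[OF w] by (simp_all add: z)
    have "((xu w)\<^sup>2 + (xv w)\<^sup>2) * ((yu w)\<^sup>2 + (yv w)\<^sup>2)
        = (xu w * yu w + xv w * yv w)\<^sup>2 + (xu w * yv w - xv w * yu w)\<^sup>2"
      by (simp add: power2_eq_square algebra_simps)
    then have "(\<phi> w)\<^sup>2 * (\<phi> w)\<^sup>2 = 0" by (simp add: a j[OF w])
    with \<phi>_pos[OF w] show False by simp
  qed
  \<comment> \<open>\<open>ru\<close>, \<open>rv\<close> are the derivatives of the logarithm of the
    modulus of \<open>x + \<i> * y\<close>, and \<open>tu\<close>, \<open>tv\<close> those of its
    argument.\<close>
  define ru where "ru w = (x w * xu w + y w * yu w) / m w" for w
  define rv where "rv w = (x w * xv w + y w * yv w) / m w" for w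
  define tu where "tu w = (x w * yu w - y w * xu w) / m w" for w
  define tv where "tv w = (x w * yv w - y w * xv w) / m w" for w
  define p where "p w = Complex (ru w) (- rv w)" for w
  define q where "q w = Complex (tu w) (- tv w)" for w
  \<comment> \<open>Both \<open>E + \<i> F\<close> and \<open>E - \<i> F\<close> are null for the
    complex bilinear extension of the form, so the logarithms of \<open>x + \<i> * y\<close> and
    \<open>x - \<i> * y\<close> are harmonic. Their gradients are \<open>p + \<i> * q\<close> and
    \<open>p - \<i> * q\<close>; since \<open>p\<close> and \<open>q\<close> are complex, both signs
    are required to separate them.\<close>
  have hol: "(\<lambda>w. Complex (xu w) (s * yu w) / Complex (x w) (s * y w)
        - \<i> * (Complex (xv w) (s * yv w) / Complex (x w) (s * y w))) holomorphic_on D"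
    if s: "s = 1 \<or> s = - 1" for s
  proof (rule log_gradient_holomorphic[OF open_D])
    fix w assume w: "w \<in> D"
    have c: "partials (\<lambda>w. Complex (f w) (s * g w)) (Complex a (s * c)) (Complex b (s * d)) w"
      if "partials f a b w" "partials g c d w" for f g a b c d
      using partials_add[OF partials_of_real[OF that(1)] partials_mult[OF partials_const[of "\<i> * of_real s"]
            partials_of_real[OF that(2)]]]
      by (simp add: Complex_eq mult.assoc)
    show "partials (\<lambda>w. Complex (x w) (s * y w)) (Complex (xu w) (s * yu w)) (Complex (xv w) (s * yv w)) w"
      by (rule c[OF px(1)[OF w] py(1)[OF w]])
    show "partials (\<lambda>w. Complex (xu w) (s * yu w)) (Complex (xuu w) (s * yuu w)) (Complex (xuv w) (s * yuv w)) w"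
      by (rule c[OF px(2)[OF w] py(2)[OF w]])
    show "partials (\<lambda>w. Complex (xv w) (s * yv w)) (Complex (xuv w) (s * yuv w)) (Complex (xvv w) (s * yvv w)) w"
      by (rule c[OF px(3)[OF w] py(3)[OF w]])
    have "s \<noteq> 0" using s by auto
    then show "Complex (x w) (s * y w) \<noteq> 0"
      using m[OF w] by (auto simp: complex_eq_iff m_def)
    have "x w * (xuu w + xvv w) - y w * (yuu w + yvv w) = xu w * xu w - yu w * yu w + (xv w * xv w - yv w * yv w)"
      using L(1,2)[OF w] by (simp add: power2_eq_square)
    moreover have "x w * (yuu w + yvv w) + y w * (xuu w + xvv w) = xu w * yu w + yu w * xu w + (xv w * yv w + yv w * xv w)"
      using L(3)[OF w] by (simp add: algebra_simps)
    moreover have "r * (- a - b) = - (r * (a + b))" for r a b :: real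
      by (simp add: algebra_simps)
    ultimately show "Complex (x w) (s * y w) * (Complex (xuu w) (s * yuu w) + Complex (xvv w) (s * yvv w))
        = Complex (xu w) (s * yu w) * Complex (xu w) (s * yu w) + Complex (xv w) (s * yv w) * Complex (xv w) (s * yv w)"
      using s by (elim disjE) (simp_all add: complex_eq_iff)
  qed
  have quot: "Complex a (s * b) / Complex (x w) (s * y w)
      = Complex ((x w * a + y w * b) / m w) (s * ((x w * b - y w * a) / m w))"
    if w: "w \<in> D" and s: "s = 1 \<or> s = - 1" for a b s w
    using m[OF w] s by (auto simp: complex_eq_iff m_def Re_divide Im_divide algebra_simps diff_divide_distrib)
  define P where "P s w = Complex (ru w) (s * tu w) - \<i> * Complex (rv w) (s * tv w)" for s w
  have hP: "P s holomorphic_on D" if "s = 1 \<or> s = - 1" for s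
    by (rule holomorphic_transform[OF hol[OF that]])
      (simp add: quot[OF _ that] P_def ru_def rv_def tu_def tv_def)
  have "(\<lambda>w. (P 1 w + P (- 1) w) / 2) holomorphic_on D"
    using hP by (intro holomorphic_intros) auto
  then have hp: "p holomorphic_on D"
    by (rule holomorphic_transform) (simp add: P_def p_def complex_eq_iff)
  have "(\<lambda>w. (P 1 w - P (- 1) w) / (2 * \<i>)) holomorphic_on D"
    using hP by (intro holomorphic_intros) auto
  then have hq: "q holomorphic_on D"
    by (rule holomorphic_transform) (simp add: P_def q_def complex_eq_iff)
  have q0: "q w \<noteq> 0" if w: "w \<in> D" for w
  proof
    assume "q w = 0"
    then have "x w * yu w - y w * xu w = 0" "x w * yv w - y w * xv w = 0"
      using m[OF w] by (simp_all add: q_def complex_eq_iff tu_def tv_def)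
    \<comment> \<open>By the three Laplace identities this sum of squares equals
      \<open>(\<phi> w)\<^sup>2 * m w\<close>, so the gradient of the argument cannot
      vanish.\<close>
    then have "(x w * yu w - y w * xu w)\<^sup>2 + (x w * yv w - y w * xv w)\<^sup>2 = 0" by simp
    also have "(x w * yu w - y w * xu w)\<^sup>2 + (x w * yv w - y w * xv w)\<^sup>2
      = (x w)\<^sup>2 * ((yu w)\<^sup>2 + (yv w)\<^sup>2) + (y w)\<^sup>2 * ((xu w)\<^sup>2 + (xv w)\<^sup>2)
        - x w * y w * (2 * (xu w * yu w + xv w * yv w))"
      by (simp add: power2_eq_square algebra_simps)
    also have "\<dots> = (\<phi> w)\<^sup>2 * m w + (x w)\<^sup>2 * (y w * (yuu w + yvv w)) + (y w)\<^sup>2 * (x w * (xuu w + xvv w))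
        - x w * y w * (x w * (yuu w + yvv w) + y w * (xuu w + xvv w))"
      unfolding L[OF w] by (simp add: m_def algebra_simps)
    also have "\<dots> = (\<phi> w)\<^sup>2 * m w" by (simp add: power2_eq_square algebra_simps)
    finally show False using m[OF w] \<phi>_pos[OF w] by simp
  qed
  have "Im (p w * cnj (q w)) = 0" if w: "w \<in> D" for w
  proof -
    have "(x w * xu w + y w * yu w) * (x w * yv w - y w * xv w)
        - (x w * xv w + y w * yv w) * (x w * yu w - y w * xu w)
        = m w * (xu w * yv w - xv w * yu w)"
      by (simp add: m_def power2_eq_square algebra_simps)
    then have "ru w * tv w = rv w * tu w"
      by (simp add: j[OF w] ru_def rv_def tu_def tv_def)
    then show ?thesis unfolding p_def q_def Im_mult_cnj_Complex by simp
  qed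
  with proportional_gradients[OF open_D connected_D nonempty_D hp hq q0]
  obtain l :: real where "\<And>w. w \<in> D \<Longrightarrow> p w = of_real l * q w" by blast
  then have l: "ru w = l * tu w" "rv w = l * tv w" if "w \<in> D" for w
    using that by (simp_all add: p_def q_def complex_eq_iff)
  define r where "r w = ln (m w) / 2" for w
  have er: "exp (2 * r w) = m w" if "w \<in> D" for w using m[OF that] by (simp add: r_def)
  have pr: "partials r (ru w) (rv w) w" if w: "w \<in> D" for w
  proof -
    have "partials m (2 * (x w * xu w + y w * yu w)) (2 * (x w * xv w + y w * yv w)) w"
      using partials_add[OF partials_mult[OF px(1) px(1)] partials_mult[OF py(1) py(1)], OF w w w w]
      by (simp add: m_def[abs_def] power2_eq_square algebra_simps)
    from partials_mult[OF partials_const[of "1/2 :: real"] partials_ln[OF this m[OF w]]] show ?thesis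
      by (simp add: r_def[abs_def] ru_def rv_def del: distrib_left_numeral)
  qed
  have g_polar: "cmod (Complex (x w) (y w)) = exp (r w)" if w: "w \<in> D" for w
  proof -
    have "(exp (r w))\<^sup>2 = m w" using er[OF w] by (simp add: exp_double)
    then show ?thesis by (simp add: cmod_def m_def[symmetric] real_sqrt_unique)
  qed
  obtain w0 where w0: "w0 \<in> D" using nonempty_D by blast
  show ?thesis
  proof (cases "l = 0")
    case True
    \<comment> \<open>For \<open>l = 0\<close> the modulus is constant and the principal argument
      can serve as \<open>\<theta>\<close>; its discontinuities do not matter.\<close>
    have "partials r 0 0 w" if "w \<in> D" for w using pr[OF that] l[OF that] True by simp
    then have c: "r w = r w0" if "w \<in> D" for w
      using partials_constant[OF open_D connected_D _ that w0] by blast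
    show ?thesis
    proof (rule that[of "r w0" l])
      fix w assume w: "w \<in> D"
      let ?g = "Complex (x w) (y w)"
      have "?g = of_real (exp (r w0)) * exp (\<i> * of_real (Arg ?g))"
        using g_polar[OF w] c[OF w] by (metis Arg_eq Arg_zero mult_zero_left of_real_0 norm_zero)
      then show "\<exists>\<theta>. Complex (lorentz (X w) E) (lorentz (X w) F) = exp (of_real (r w0) + Complex l 1 * of_real \<theta>)"
        by (intro exI[of _ "Arg ?g"]) (simp add: True x_def y_def exp_add exp_of_real Complex_eq)
    qed
  next
    case False
    let ?g = "\<lambda>w. Complex (x w) (y w)"
    \<comment> \<open>For \<open>l \<noteq> 0\<close> the quotient \<open>r w / l\<close> is a
      single-valued substitute for the argument. \<open>h\<close> compares the two: formally it is
      \<open>exp (\<i> * (r / l - \<theta>))\<close>, and the proportionality of the gradients makes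
      it constant.\<close>
    define h where "h w = cnj (?g w) * exp ((\<i> / of_real l - 1) * of_real (r w))" for w
    have "partials h 0 0 w" if w: "w \<in> D" for w
    proof -
      have g: "partials (\<lambda>w. cnj (?g w)) (Complex (xu w) (- yu w)) (Complex (xv w) (- yv w)) w"
        using partials_diff[OF partials_of_real[OF px(1)[OF w]]
            partials_mult[OF partials_const[of \<i>] partials_of_real[OF py(1)[OF w]]]]
        by (simp add: Complex_eq)
      have gu: "Complex a (- b) = cnj (?g w) * Complex ((x w * a + y w * b) / m w) (- ((x w * b - y w * a) / m w))" for a b
      proof -
        have q: "Complex a (- b) / cnj (?g w) = Complex ((x w * a + y w * b) / m w) (- ((x w * b - y w * a) / m w))"
          using quot[OF w, of "- 1" a b] by (simp add: complex_cnj minus_divide_left)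
        have "cnj (?g w) \<noteq> 0" using m[OF w] by (auto simp: complex_eq_iff m_def)
        then show ?thesis unfolding q[symmetric] by simp
      qed
      have e: "partials (\<lambda>w. exp ((\<i> / of_real l - 1) * of_real (r w)))
         (exp ((\<i> / of_real l - 1) * of_real (r w)) * ((\<i> / of_real l - 1) * of_real (ru w)))
         (exp ((\<i> / of_real l - 1) * of_real (r w)) * ((\<i> / of_real l - 1) * of_real (rv w))) w"
        using partials_exp[OF partials_mult[OF partials_const partials_of_real[OF pr[OF w]]]] by simp
      have z: "Complex (ru w) (- tu w) + (\<i> / of_real l - 1) * of_real (ru w) = 0"
        "Complex (rv w) (- tv w) + (\<i> / of_real l - 1) * of_real (rv w) = 0"
        using l[OF w] False by (simp_all add: Complex_eq algebra_simps)
      have z': "c * a * e + c * (e * b) = 0" if "a + b = 0" for a b c e :: complex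
      proof -
        have "c * a * e + c * (e * b) = c * e * (a + b)" by (simp add: algebra_simps)
        then show ?thesis using that by simp
      qed
      show ?thesis
        using partials_mult[OF g e] unfolding gu[of "xu w" "yu w"] gu[of "xv w" "yv w"] ru_def[symmetric] rv_def[symmetric] tu_def[symmetric] tv_def[symmetric]
          z'[OF z(1)] z'[OF z(2)] h_def[symmetric] .
    qed
    then have h0: "h w = h w0" if "w \<in> D" for w
      using partials_constant[OF open_D connected_D _ that w0] by blast
    have "cmod (h w0) = 1"
    proof -
      have "cmod (exp ((\<i> / of_real l - 1) * of_real (r w0))) = exp (- r w0)" by simp
      then show ?thesis
        using g_polar[OF w0] by (simp add: h_def norm_mult complex_mod_cnj exp_minus del: complex_cnj)
    qed
    then obtain \<alpha> where \<alpha>: "h w0 = exp (\<i> * of_real \<alpha>)"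
      by (metis complex_norm_eq_1_exp_eq)
    show ?thesis
    \<comment> \<open>The constant \<open>\<alpha>\<close> is \<open>r w / l - \<theta>\<close>, so
      the logarithm of the modulus is \<open>l * \<alpha> + l * \<theta>\<close>.\<close>
    proof (rule that[of "l * \<alpha>" l])
      fix w assume w: "w \<in> D"
      let ?e = "(\<i> / of_real l - 1) * complex_of_real (r w)"
      have "cnj (?g w) = h w * exp (- ?e)"
        by (simp add: h_def exp_minus del: complex_cnj)
      also have "\<dots> = exp (\<i> * of_real \<alpha> - ?e)"
        by (simp only: h0[OF w] \<alpha> exp_add[symmetric] diff_conv_add_uminus)
      finally have "?g w = exp (cnj (\<i> * of_real \<alpha> - ?e))"
        by (metis complex_cnj_cnj exp_cnj)
      also have "cnj (\<i> * of_real \<alpha> - ?e) = of_real (l * \<alpha>) + Complex l 1 * of_real (r w / l - \<alpha>)"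
        using False by (simp add: Complex_eq field_simps)
      finally show "\<exists>\<theta>. Complex (lorentz (X w) E) (lorentz (X w) F) = exp (of_real (l * \<alpha>) + Complex l 1 * of_real \<theta>)"
        unfolding x_def y_def by blast
    qed
  qed
qed

text \<open>The axis has a single null direction, so only one logarithm is available. The second
  harmonic function is the quotient \<open>g / f\<close>: its Laplacian is a combination of the
  identities for the pairs \<open>N, N\<close> and \<open>N, E\<close>. The identity for
  \<open>E, E\<close> gives the quotient a gradient without zeros.\<close>

lemma degenerate_axis_relation:
  assumes N: "lorentz N N = 0" "lorentz E E = 1" "lorentz N E = 0"
    and neg: "\<And>w. w \<in> D \<Longrightarrow> lorentz (X w) N < 0"
    and jac: "\<And>w. w \<in> D \<Longrightarrow>
      lorentz (du X w) N * lorentz (dv X w) E = lorentz (dv X w) N * lorentz (du X w) E"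
  obtains l k where "\<And>w. w \<in> D \<Longrightarrow> ln (- lorentz (X w) N) = l * (lorentz (X w) E / lorentz (X w) N) + k"
proof -
  define f where "f w = lorentz (X w) N" for w
  define g where "g w = lorentz (X w) E" for w
  define fu where "fu w = lorentz (du X w) N" for w
  define fv where "fv w = lorentz (dv X w) N" for w
  define gu where "gu w = lorentz (du X w) E" for w
  define gv where "gv w = lorentz (dv X w) E" for w
  define fuu where "fuu w = lorentz (du (du X) w) N" for w
  define fuv where "fuv w = lorentz (dv (du X) w) N" for w
  define fvv where "fvv w = lorentz (dv (dv X) w) N" for w
  define guu where "guu w = lorentz (du (du X) w) E" for w
  define guv where "guv w = lorentz (dv (du X) w) E" for w
  define gvv where "gvv w = lorentz (dv (dv X) w) E" for w
  note d = f_def g_def fu_def fv_def gu_def gv_def fuu_def fuv_def fvv_def guu_def guv_def gvv_def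
  have pf: "partials f (fu w) (fv w) w" "partials fu (fuu w) (fuv w) w" "partials fv (fuv w) (fvv w) w"
    and pg: "partials g (gu w) (gv w) w" "partials gu (guu w) (guv w) w" "partials gv (guv w) (gvv w) w"
    if "w \<in> D" for w
    using partials_coord[OF that] partials_coord_u[OF that] partials_coord_v[OF that]
    by (simp_all add: d[abs_def])
  have f: "f w < 0" if "w \<in> D" for w using neg[OF that] by (simp add: f_def)
  have f0: "f w \<noteq> 0" if "w \<in> D" for w using f[OF that] by simp
  have L: "f w * (fuu w + fvv w) = fu w * fu w + fv w * fv w"
    "f w * (guu w + gvv w) + g w * (fuu w + fvv w) = 2 * (fu w * gu w + fv w * gv w)"
    "g w * (guu w + gvv w) = gu w * gu w + gv w * gv w - (\<phi> w)\<^sup>2" if w: "w \<in> D" for w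
    using laplace_identity[OF w, of N N] laplace_identity[OF w, of N E] laplace_identity[OF w, of E E] N
    by (simp_all add: d lap_def lorentz_simps)
  define hu where "hu w = (gu w * f w - g w * fu w) / (f w * f w)" for w
  define hv where "hv w = (gv w * f w - g w * fv w) / (f w * f w)" for w
  define p where "p w = Complex (fu w / f w) (- (fv w / f w))" for w
  define q where "q w = Complex (hu w) (- hv w)" for w
  have hp: "p holomorphic_on D"
    unfolding p_def d by (rule null_coord_log_gradient) (use N neg in force)+
  define nu where "nu w = gu w * f w - g w * fu w" for w
  define nv where "nv w = gv w * f w - g w * fv w" for w
  define nuu where "nuu w = guu w * f w - g w * fuu w" for w
  define nuv where "nuv w = guv w * f w + gu w * fv w - (gv w * fu w + g w * fuv w)" for w
  define nvu where "nvu w = guv w * f w + gv w * fu w - (gu w * fv w + g w * fuv w)" for w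
  define nvv where "nvv w = gvv w * f w - g w * fvv w" for w
  define huu where "huu w = (nuu w * (f w * f w) - nu w * (2 * f w * fu w)) / (f w * f w)\<^sup>2" for w
  define huv where "huv w = (nuv w * (f w * f w) - nu w * (2 * f w * fv w)) / (f w * f w)\<^sup>2" for w
  define hvv where "hvv w = (nvv w * (f w * f w) - nv w * (2 * f w * fv w)) / (f w * f w)\<^sup>2" for w
  have "(\<lambda>w. of_real (hu w) - \<i> * of_real (hv w)) holomorphic_on D"
  proof (rule gradient_holomorphic[OF open_D partials_of_real[of _ "huu _" "huv _"] partials_of_real[of _ "huv _" "hvv _"]])
    fix w assume w: "w \<in> D"
    have ff: "partials (\<lambda>w. f w * f w) (2 * f w * fu w) (2 * f w * fv w) w"
      using partials_mult[OF pf(1)[OF w] pf(1)[OF w]] by (simp add: algebra_simps)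
    have ff0: "f w * f w \<noteq> 0" using f0[OF w] by simp
    have "partials nu (nuu w) (nuv w) w"
      using partials_diff[OF partials_mult[OF pg(2) pf(1)] partials_mult[OF pg(1) pf(2)], OF w w w w]
      by (simp add: nu_def[abs_def] nuu_def nuv_def algebra_simps)
    from partials_divide[OF this ff ff0] show "partials hu (huu w) (huv w) w"
      by (simp add: hu_def[abs_def] nu_def huu_def huv_def)
    have nv: "partials nv (nvu w) (nvv w) w"
      using partials_diff[OF partials_mult[OF pg(3) pf(1)] partials_mult[OF pg(1) pf(3)], OF w w w w]
      by (simp add: nv_def[abs_def] nvu_def nvv_def algebra_simps)
    have "nvu w * (f w * f w) - nv w * (2 * f w * fu w) = nuv w * (f w * f w) - nu w * (2 * f w * fv w)"
      by (simp add: nu_def nv_def nuv_def nvu_def algebra_simps)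
    with partials_divide[OF nv ff ff0] show "partials hv (huv w) (hvv w) w"
      by (simp add: hv_def[abs_def] nv_def huv_def hvv_def)
    \<comment> \<open>The left side is the Laplacian of \<open>g / f\<close> multiplied by the
      fourth power of \<open>f\<close>; both brackets on the right vanish by the Laplace
      identities.\<close>
    have "nuu w * (f w * f w) - nu w * (2 * f w * fu w) + (nvv w * (f w * f w) - nv w * (2 * f w * fv w))
      = (f w)\<^sup>2 * ((f w * (guu w + gvv w) + g w * (fuu w + fvv w)) - 2 * (fu w * gu w + fv w * gv w))
        - 2 * f w * g w * (f w * (fuu w + fvv w) - (fu w * fu w + fv w * fv w))"
      by (simp add: nuu_def nvv_def nu_def nv_def power2_eq_square algebra_simps)
    also have "\<dots> = 0" unfolding L[OF w] by simp
    finally have "huu w + hvv w = 0" by (simp add: huu_def hvv_def add_divide_distrib[symmetric])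
    then show "complex_of_real (huu w) + of_real (hvv w) = 0"
      by (simp add: of_real_add[symmetric] del: of_real_add)
  qed
  then have hq: "q holomorphic_on D"
    by (rule holomorphic_transform) (simp add: q_def Complex_eq)
  have q0: "q w \<noteq> 0" if w: "w \<in> D" for w
  proof
    assume "q w = 0"
    then have z: "gu w * f w - g w * fu w = 0" "gv w * f w - g w * fv w = 0"
      using f0[OF w] by (simp_all add: q_def complex_eq_iff hu_def hv_def)
    \<comment> \<open>Modulo the first two identities, \<open>(\<phi> w)\<^sup>2\<close> is the
      squared gradient of \<open>g / f\<close> times the square of \<open>f\<close>.\<close>
    have "f w * f w * (\<phi> w)\<^sup>2 = f w * f w * (gu w * gu w + gv w * gv w - g w * (guu w + gvv w))"
      unfolding L(3)[OF w] by simp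
    also have "\<dots> = (gu w * f w - g w * fu w)\<^sup>2 + (gv w * f w - g w * fv w)\<^sup>2
      - f w * g w * (f w * (guu w + gvv w) + g w * (fuu w + fvv w) - 2 * (fu w * gu w + fv w * gv w))
      + (g w)\<^sup>2 * (f w * (fuu w + fvv w) - (fu w * fu w + fv w * fv w))"
      by (simp add: power2_eq_square algebra_simps)
    also have "\<dots> = 0" unfolding L(1,2)[OF w] z by simp
    finally show False using f0[OF w] \<phi>_pos[OF w] by simp
  qed
  have "Im (p w * cnj (q w)) = 0" if w: "w \<in> D" for w
  proof -
    have "fu w * gv w = fv w * gu w" using jac[OF w] by (simp add: d)
    then have "fu w * (gv w * f w - g w * fv w) = fv w * (gu w * f w - g w * fu w)"
      by (simp add: algebra_simps)
    then have "fu w / f w * hv w = fv w / f w * hu w"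
      by (simp add: hu_def hv_def)
    then show ?thesis unfolding p_def q_def Im_mult_cnj_Complex by simp
  qed
  with proportional_gradients[OF open_D connected_D nonempty_D hp hq q0]
  obtain l :: real where "\<And>w. w \<in> D \<Longrightarrow> p w = of_real l * q w" by blast
  then have l: "fu w / f w = l * hu w" "fv w / f w = l * hv w" if "w \<in> D" for w
    using that by (simp_all add: p_def q_def complex_eq_iff)
  let ?h = "\<lambda>w. ln (- f w) - l * (g w / f w)"
  have h: "partials ?h 0 0 w" if w: "w \<in> D" for w
  proof -
    have "partials (\<lambda>w. ln (- f w)) (fu w / f w) (fv w / f w) w"
      using partials_ln[OF partials_diff[OF partials_const[of 0] pf(1)[OF w]]] f[OF w] by simp
    moreover have "partials (\<lambda>w. g w / f w) (hu w) (hv w) w"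
      using partials_divide[OF pg(1)[OF w] pf(1)[OF w] f0[OF w]] by (simp add: hu_def hv_def power2_eq_square)
    ultimately show ?thesis
      using partials_diff[OF _ partials_mult[OF partials_const[of l]]] l[OF w] by fastforce
  qed
  obtain w0 where w0: "w0 \<in> D" using nonempty_D by blast
  have "?h w = ?h w0" if "w \<in> D" for w
    by (rule partials_constant[OF open_D connected_D h that w0])
  then show ?thesis by (intro that[of l "?h w0"]) (simp add: algebra_simps f_def g_def)
qed

end

section \<open>Rotational surfaces\<close>

text \<open>A null matrix is determined by its diagonal and the argument of its off-diagonal entry.
  The diagonal obeys \<open>rel\<close>, the argument is the free rotation parameter.\<close>

lemma herm_in_elliptic_catenoid:
  assumes pos: "v$1 + v$4 > 0" "v$1 - v$4 > 0" and null: "(v$2)\<^sup>2 + (v$3)\<^sup>2 = (v$1 + v$4) * (v$1 - v$4)"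
    and rel: "ln (v$1 + v$4) + ln (v$1 - v$4) = l * (ln (v$1 - v$4) - ln (v$1 + v$4))"
  shows "herm v \<in> range (elliptic_catenoid (2 * l))"
proof -
  define A where "A = v$1 + v$4"
  define B where "B = v$1 - v$4"
  define g where "g = Complex (v$2) (v$3)"
  \<comment> \<open>Read off the catenoid: the diagonal logarithms differ by \<open>4 * v\<close>
    and sum to \<open>2 * a * v\<close>, whence \<open>a = 2 * l\<close>; the argument is
    \<open>2 * u\<close>.\<close>
  define s where "s = (ln B - ln A) / 4"
  define u where "u = Arg g / 2"
  have AB: "A > 0" "B > 0" using pos by (simp_all add: A_def B_def)
  have rel': "ln A + ln B = 4 * l * s" "ln B - ln A = 4 * s"
    using rel by (simp_all add: A_def B_def s_def)
  have A: "A = exp ((2 * l - 2) * s)"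
  proof -
    have "ln A = (2 * l - 2) * s" using rel' by (simp add: algebra_simps)
    then show ?thesis using AB by (metis exp_ln)
  qed
  have B: "B = exp ((2 * l + 2) * s)"
  proof -
    have "ln B = (2 * l + 2) * s" using rel' by (simp add: algebra_simps)
    then show ?thesis using AB by (metis exp_ln)
  qed
  have g: "g = exp (2 * \<i> * of_real u + of_real (2 * l) * of_real s)"
  proof -
    have "(exp (2 * l * s))\<^sup>2 = A * B"
      unfolding A B exp_add[symmetric] exp_double[symmetric] by (simp add: algebra_simps)
    then have "cmod g = exp (2 * l * s)"
      using null by (simp add: g_def cmod_def A_def B_def real_sqrt_unique)
    moreover have "g = of_real (cmod g) * exp (\<i> * of_real (Arg g))"
      by (metis Arg_eq mult_zero_left norm_zero of_real_0)
    ultimately have "g = of_real (exp (2 * l * s)) * exp (\<i> * of_real (Arg g))" by metis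
    also have "\<dots> = exp (of_real (2 * l * s) + \<i> * of_real (Arg g))"
      by (simp only: exp_add exp_of_real)
    finally show ?thesis by (simp add: u_def add.commute)
  qed
  have "cnj g = exp (cnj (2 * \<i> * of_real u + of_real (2 * l) * of_real s))"
    by (subst g) (rule exp_cnj)
  then have cg: "cnj g = exp (- 2 * \<i> * of_real u + of_real (2 * l) * of_real s)" by simp
  have "elliptic_catenoid (2 * l) (Complex u s) = mat2 (of_real A) g (cnj g) (of_real B)"
    unfolding elliptic_catenoid_def Let_def mat2_eq_iff cg
    unfolding g A B by (simp add: exp_of_real[symmetric])
  moreover have "herm v = mat2 (of_real A) g (cnj g) (of_real B)"
    by (simp add: herm_def mat2_eq_iff g_def A_def B_def complex_eq_iff)
  ultimately show ?thesis by (metis rangeI)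
qed

text \<open>The roles are exchanged: the off-diagonal entry lies on the spiral and fixes
  \<open>v\<close> as half of \<open>\<theta>\<close>, while the ratio of the diagonal entries is
  \<open>exp (4 * u)\<close> with \<open>u\<close> free.\<close>

lemma herm_in_hyperbolic_catenoid:
  assumes pos: "v$1 + v$4 > 0" "v$1 - v$4 > 0" and null: "(v$2)\<^sup>2 + (v$3)\<^sup>2 = (v$1 + v$4) * (v$1 - v$4)"
    and rel: "Complex (v$2) (v$3) = exp (Complex l 1 * of_real \<theta>)"
  shows "herm v \<in> range (hyperbolic_catenoid (2 * l))"
proof -
  define A where "A = v$1 + v$4"
  define B where "B = v$1 - v$4"
  define g where "g = Complex (v$2) (v$3)"
  define u where "u = (ln A - ln B) / 4"
  have AB: "A > 0" "B > 0" using pos by (simp_all add: A_def B_def)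
  have "cmod g = exp (l * \<theta>)" unfolding g_def rel by simp
  moreover have "(cmod g)\<^sup>2 = A * B" using null by (simp add: g_def cmod_power2 A_def B_def)
  ultimately have "ln (A * B) = ln ((exp (l * \<theta>))\<^sup>2)" by simp
  then have lAB: "ln A + ln B = 2 * l * \<theta>" using AB by (simp add: ln_mult exp_double[symmetric])
  have A: "A = exp (2 * u + 2 * l * (\<theta> / 2))"
  proof -
    have "ln A = 2 * u + 2 * l * (\<theta> / 2)" using lAB by (simp add: u_def field_simps)
    then show ?thesis using AB by (metis exp_ln)
  qed
  have B: "B = exp (- 2 * u + 2 * l * (\<theta> / 2))"
  proof -
    have "ln B = - 2 * u + 2 * l * (\<theta> / 2)" using lAB by (simp add: u_def field_simps)
    then show ?thesis using AB by (metis exp_ln)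
  qed
  have g: "g = exp ((of_real (2 * l) + 2 * \<i>) * of_real (\<theta> / 2))"
    unfolding g_def rel by (rule arg_cong[where f = exp]) (simp add: Complex_eq field_simps)
  have "cnj g = exp (cnj ((of_real (2 * l) + 2 * \<i>) * of_real (\<theta> / 2)))"
    by (subst g) (rule exp_cnj)
  then have cg: "cnj g = exp ((of_real (2 * l) - 2 * \<i>) * of_real (\<theta> / 2))" by simp
  have "hyperbolic_catenoid (2 * l) (Complex u (\<theta> / 2)) = mat2 (of_real A) g (cnj g) (of_real B)"
    unfolding hyperbolic_catenoid_def Let_def mat2_eq_iff cg
    unfolding g A B by (simp add: exp_of_real[symmetric])
  moreover have "herm v = mat2 (of_real A) g (cnj g) (of_real B)"
    by (simp add: herm_def mat2_eq_iff g_def A_def B_def complex_eq_iff)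
  ultimately show ?thesis by (metis rangeI)
qed

text \<open>The parameters are the components of the off-diagonal entry divided by the lower right
  one; nullity then forces the upper left entry, which may vanish.\<close>

lemma herm_in_parabolic_catenoid:
  assumes pos: "v$1 - v$4 > 0" and null: "(v$2)\<^sup>2 + (v$3)\<^sup>2 = (v$1 + v$4) * (v$1 - v$4)"
    and rel: "ln (v$1 - v$4) = c * (v$3 / (v$1 - v$4))"
  shows "herm v \<in> range (parabolic_catenoid c)"
proof -
  define A where "A = v$1 + v$4"
  define B where "B = v$1 - v$4"
  define u where "u = v$2 / B"
  define s where "s = v$3 / B"
  have B0: "B > 0" using pos by (simp add: B_def)
  have B: "exp (c * s) = B" using rel B0 by (metis B_def s_def exp_ln)
  have g: "v$2 = B * u" "v$3 = B * s" using B0 by (simp_all add: u_def s_def)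
  have "A * B = B\<^sup>2 * (u\<^sup>2 + s\<^sup>2)"
    using null by (simp add: g A_def[symmetric] B_def[symmetric] power_mult_distrib distrib_left)
  then have A: "A = B * (u\<^sup>2 + s\<^sup>2)" using B0 by (simp add: power2_eq_square)
  have "parabolic_catenoid c (Complex u s) = mat2 (of_real A) (Complex (v$2) (v$3)) (Complex (v$2) (- v$3)) (of_real B)"
    unfolding parabolic_catenoid_def Let_def mat2_eq_iff A g
    by (simp add: Complex_eq B[symmetric] exp_of_real[symmetric] algebra_simps)
  then have "parabolic_catenoid c (Complex u s) = herm v"
    by (simp add: herm_def A_def B_def)
  then show ?thesis by (metis rangeI)
qed

section \<open>Rotational invariance and the three types of axis\<close>

lemma cone_isometry_inj:
  assumes "cone_isometry T" "T a = T b"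
  shows "a = b"
proof (rule lorentz_eqI)
  show "lorentz a v = lorentz b v" for v
    using assms by (metis cone_isometry_def)
qed

text \<open>The position of a point of the surface relative to the axis \<open>P\<close> depends only on the point of
  the profile curve that it comes from.\<close>

locale rotational_zmc = zmc_immersion +
  fixes P :: "L4 set" and I :: "real set" and \<gamma> :: "real \<Rightarrow> L4"
  assumes subspace_P: "subspace P"
    and curve: "regular_curve I \<gamma>" "\<gamma> ` I \<inter> P = {}"
    and image: "X ` D = {T (\<gamma> t) |T t. T \<in> rotation_group P \<and> t \<in> I}"
begin

lemma profile:
  assumes "w \<in> D"
  obtains T t where "cone_isometry T" "\<forall>N\<in>P. T N = N" "t \<in> I" "X w = T (\<gamma> t)"
  using image assms unfolding rotation_group_def by blast

lemma off_axis:
  assumes "w \<in> D"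
  shows "X w \<notin> P"
proof
  assume P: "X w \<in> P"
  obtain T t where T: "cone_isometry T" "\<forall>N\<in>P. T N = N" "t \<in> I" "X w = T (\<gamma> t)"
    using profile[OF assms] .
  then have "T (X w) = T (\<gamma> t)" using P by simp
  then have "X w = \<gamma> t" using cone_isometry_inj[OF T(1)] by blast
  with P T(3) curve(2) show False by (metis IntI emptyE imageI)
qed

lemma axis_jacobian:
  assumes w: "w \<in> D" and N: "N \<in> P" "M \<in> P"
  shows "lorentz (du X w) N * lorentz (dv X w) M = lorentz (dv X w) N * lorentz (du X w) M"
proof (rule jacobian_zero_of_image_in_curve[OF open_D partials_coord partials_coord _ _ w])
  let ?c = "\<lambda>v. Complex (lorentz v N) (lorentz v M)"
  have "linear ?c" by (rule linearI) (simp_all add: lorentz_simps complex_eq_iff)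
  then have c: "bounded_linear ?c" by (simp add: linear_linear)
  have "Ck_on (Suc 0) \<gamma> I" using curve(1) by (auto simp: regular_curve_def smooth_on_def)
  then have "\<gamma> differentiable (at t)" if "t \<in> I" for t using that by simp
  then have "(\<lambda>t. ?c (\<gamma> t)) differentiable (at t)" if "t \<in> I" for t
    using bounded_linear.has_derivative[OF c] that unfolding differentiable_def by blast
  then show "(\<lambda>t. ?c (\<gamma> t)) differentiable_on I"
    by (simp add: differentiable_at_imp_differentiable_on)
  fix z assume "z \<in> D"
  then obtain T t where T: "cone_isometry T" "\<forall>N\<in>P. T N = N" "t \<in> I" "X z = T (\<gamma> t)"
    by (rule profile)
  have "lorentz (X z) L = lorentz (\<gamma> t) L" if "L \<in> P" for L
    using T(1,2,4) that by (metis cone_isometry_def)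
  then show "?c (X z) \<in> (\<lambda>t. ?c (\<gamma> t)) ` I"
    using N T(3) by auto
qed

text \<open>The equation is the vanishing of the determinant of the Hermitian matrix. On the cone
  the diagonal entries are only nonnegative; strict positivity is obtained separately in each
  case.\<close>

lemma frame_coords_null:
  assumes fr: "lorentz_frame T E2 E3 E4" and w: "w \<in> D"
  defines "c \<equiv> frame_coords T E2 E3 E4 (X w)"
  shows "(c$2)\<^sup>2 + (c$3)\<^sup>2 = (c$1 + c$4) * (c$1 - c$4)" "c$1 + c$4 \<ge> 0" "c$1 - c$4 \<ge> 0"
proof -
  have "c \<in> light_cone"
    using cone_isometry_frame_coords[OF fr] in_cone[OF w] unfolding cone_isometry_def c_def by blast
  then have c: "c$1 > 0" "(c$1)\<^sup>2 = (c$2)\<^sup>2 + (c$3)\<^sup>2 + (c$4)\<^sup>2"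
    by (simp_all add: light_cone_iff lorentz_def power2_eq_square)
  then show "(c$2)\<^sup>2 + (c$3)\<^sup>2 = (c$1 + c$4) * (c$1 - c$4)" by (simp add: power2_eq_square algebra_simps)
  have "(c$4)\<^sup>2 \<le> (c$1)\<^sup>2" using c(2) by simp
  then have "\<bar>c$4\<bar> \<le> c$1" using c(1) by (simp add: abs_le_square_iff[symmetric])
  then show "c$1 + c$4 \<ge> 0" "c$1 - c$4 \<ge> 0" by simp_all
qed

text \<open>A point of the cone orthogonal to a null vector of the axis is a multiple of it and
  would lie on the axis, which the surface avoids.\<close>

lemma null_axis_direction:
  assumes N: "N \<in> P" "lorentz N N = 0" "N \<noteq> 0" and w: "w \<in> D"
  shows "lorentz (X w) N \<noteq> 0"
proof
  assume "lorentz (X w) N = 0"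
  then obtain k where "X w = k *\<^sub>R N" using null_orthogonal_parallel[OF gram_XX[OF w] N(2,3)] by blast
  then have "X w \<in> P" using subspace_P N(1) by (simp add: subspace_scale)
  with off_axis[OF w] show False ..
qed

lemma congruent_to_piece_ofI:
  assumes "lorentz_frame T E2 E3 E4" "r > 0"
    and "\<And>w. w \<in> D \<Longrightarrow> herm (r *\<^sub>R frame_coords T E2 E3 E4 (X w)) \<in> range M"
  shows "congruent_to_piece_of (X ` D) M"
  unfolding congruent_to_piece_of_def
  using assms cone_isometry_frame_coords[OF assms(1)] by blast

lemma elliptic_case:
  assumes fr: "lorentz_frame T E2 E3 E4" and P: "T \<in> P" "E4 \<in> P"
  shows "\<exists>a. congruent_to_piece_of (X ` D) (elliptic_catenoid a)"
proof -
  note F = fr[unfolded lorentz_frame_def]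
  let ?c = "\<lambda>w. frame_coords T E2 E3 E4 (X w)"
  \<comment> \<open>\<open>N\<close> and \<open>M\<close> span the null lines of the axis; pairing
    with them gives minus the diagonal entries of the Hermitian matrix.\<close>
  define N where "N = T - E4"
  define M where "M = T + E4"
  have NM: "lorentz N N = 0" "lorentz M M = 0" "lorentz N M = - 2"
    using F by (simp_all add: N_def M_def lorentz_simps lorentz_commute[of T E4])
  have "lorentz N T = - 1" "lorentz M T = - 1" using F by (simp_all add: N_def M_def lorentz_simps)
  then have nz: "N \<noteq> 0" "M \<noteq> 0" by (auto simp: lorentz_simps)
  have NMP: "N \<in> P" "M \<in> P" using P subspace_P by (simp_all add: N_def M_def subspace_diff subspace_add)
  have c: "lorentz (X w) N = - (?c w$1 + ?c w$4)" "lorentz (X w) M = - (?c w$1 - ?c w$4)" for w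
    by (simp_all add: N_def M_def lorentz_simps)
  have neg: "lorentz (X w) N < 0" "lorentz (X w) M < 0" if w: "w \<in> D" for w
    using null_axis_direction[OF NMP(1) NM(1) nz(1) w] null_axis_direction[OF NMP(2) NM(2) nz(2) w]
      frame_coords_null(2,3)[OF fr w] unfolding c by linarith+
  obtain l k where lk: "\<And>w. w \<in> D \<Longrightarrow> ln (- lorentz (X w) N) + ln (- lorentz (X w) M) =
      l * (ln (- lorentz (X w) M) - ln (- lorentz (X w) N)) + k"
    using lorentzian_axis_relation[OF NM(1,2) _ neg axis_jacobian[OF _ NMP]] NM(3) by auto
  \<comment> \<open>Scaling by \<open>r\<close> adds \<open>2 * ln r\<close> to the sum of the
    logarithms and leaves their difference alone, so this \<open>r\<close> removes
    \<open>k\<close>.\<close>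
  define r where "r = exp (- k / 2)"
  have r: "r > 0" "ln r = - k / 2" by (simp_all add: r_def)
  have "herm (r *\<^sub>R ?c w) \<in> range (elliptic_catenoid (2 * l))" if w: "w \<in> D" for w
  proof (rule herm_in_elliptic_catenoid)
    define A where "A = ?c w$1 + ?c w$4"
    define B where "B = ?c w$1 - ?c w$4"
    have AB: "A > 0" "B > 0" using neg[OF w] unfolding c A_def B_def by simp_all
    have e: "(r *\<^sub>R ?c w)$1 + (r *\<^sub>R ?c w)$4 = r * A" "(r *\<^sub>R ?c w)$1 - (r *\<^sub>R ?c w)$4 = r * B"
      by (simp_all add: A_def B_def algebra_simps)
    show "(r *\<^sub>R ?c w)$1 + (r *\<^sub>R ?c w)$4 > 0" "(r *\<^sub>R ?c w)$1 - (r *\<^sub>R ?c w)$4 > 0"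
      unfolding e using AB r by simp_all
    have "r\<^sup>2 * ((?c w$2)\<^sup>2 + (?c w$3)\<^sup>2) = r\<^sup>2 * (A * B)"
      unfolding A_def B_def frame_coords_null(1)[OF fr w] ..
    then show "((r *\<^sub>R ?c w)$2)\<^sup>2 + ((r *\<^sub>R ?c w)$3)\<^sup>2
        = ((r *\<^sub>R ?c w)$1 + (r *\<^sub>R ?c w)$4) * ((r *\<^sub>R ?c w)$1 - (r *\<^sub>R ?c w)$4)"
      unfolding e by (simp add: power_mult_distrib distrib_left power2_eq_square mult_ac)
    have "ln A + ln B = l * (ln B - ln A) + k"
      using lk[OF w] unfolding c A_def B_def minus_minus .
    then show "ln ((r *\<^sub>R ?c w)$1 + (r *\<^sub>R ?c w)$4) + ln ((r *\<^sub>R ?c w)$1 - (r *\<^sub>R ?c w)$4)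
        = l * (ln ((r *\<^sub>R ?c w)$1 - (r *\<^sub>R ?c w)$4) - ln ((r *\<^sub>R ?c w)$1 + (r *\<^sub>R ?c w)$4))"
      unfolding e using AB r by (simp add: ln_mult)
  qed
  then show ?thesis using congruent_to_piece_ofI[OF fr r(1)] by blast
qed

lemma hyperbolic_case:
  assumes fr: "lorentz_frame T E2 E3 E4" and P: "E2 \<in> P" "E3 \<in> P"
  shows "\<exists>b. congruent_to_piece_of (X ` D) (hyperbolic_catenoid b)"
proof -
  note F = fr[unfolded lorentz_frame_def]
  let ?c = "\<lambda>w. frame_coords T E2 E3 E4 (X w)"
  obtain l k :: real where lk: "\<And>w. w \<in> D \<Longrightarrow>
      \<exists>\<theta>::real. Complex (lorentz (X w) E2) (lorentz (X w) E3) = exp (of_real k + Complex l 1 * of_real \<theta>)"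
    using riemannian_axis_relation[OF _ _ _ axis_jacobian[OF _ P]] F by blast
  define r where "r = exp (- k)"
  have r: "r > 0" by (simp add: r_def)
  have "herm (r *\<^sub>R ?c w) \<in> range (hyperbolic_catenoid (2 * l))" if w: "w \<in> D" for w
  proof -
    obtain \<theta> :: real where \<theta>: "Complex (?c w$2) (?c w$3) = exp (of_real k + Complex l 1 * of_real \<theta>)"
      using lk[OF w] by auto
    have "Complex ((r *\<^sub>R ?c w)$2) ((r *\<^sub>R ?c w)$3) = of_real r * Complex (?c w$2) (?c w$3)"
      by (simp add: complex_eq_iff)
    also have "\<dots> = exp (of_real (- k)) * exp (of_real k + Complex l 1 * of_real \<theta>)"
      unfolding \<theta> r_def exp_of_real ..
    also have "\<dots> = exp (Complex l 1 * of_real \<theta>)" by (simp add: exp_add[symmetric])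
    finally have rel: "Complex ((r *\<^sub>R ?c w)$2) ((r *\<^sub>R ?c w)$3) = exp (Complex l 1 * of_real \<theta>)" .
    define A where "A = ?c w$1 + ?c w$4"
    define B where "B = ?c w$1 - ?c w$4"
    have e: "(r *\<^sub>R ?c w)$1 + (r *\<^sub>R ?c w)$4 = r * A" "(r *\<^sub>R ?c w)$1 - (r *\<^sub>R ?c w)$4 = r * B"
      by (simp_all add: A_def B_def algebra_simps)
    have null: "(?c w$2)\<^sup>2 + (?c w$3)\<^sup>2 = A * B"
      unfolding A_def B_def frame_coords_null(1)[OF fr w] ..
    \<comment> \<open>The spiral avoids the origin, so by nullity neither diagonal entry can
      vanish.\<close>
    have "Complex (?c w$2) (?c w$3) \<noteq> 0" unfolding \<theta> by simp
    then have "A * B \<noteq> 0" unfolding null[symmetric] by (simp add: complex_eq_iff sum_power2_eq_zero_iff)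
    then have AB: "A > 0" "B > 0"
      using frame_coords_null(2,3)[OF fr w] unfolding A_def B_def by (auto simp: order.order_iff_strict)
    show ?thesis
    proof (rule herm_in_hyperbolic_catenoid[OF _ _ _ rel])
      show "(r *\<^sub>R ?c w)$1 + (r *\<^sub>R ?c w)$4 > 0" "(r *\<^sub>R ?c w)$1 - (r *\<^sub>R ?c w)$4 > 0"
        unfolding e using AB r by simp_all
      have "r\<^sup>2 * ((?c w$2)\<^sup>2 + (?c w$3)\<^sup>2) = r\<^sup>2 * (A * B)" unfolding null ..
      then show "((r *\<^sub>R ?c w)$2)\<^sup>2 + ((r *\<^sub>R ?c w)$3)\<^sup>2
          = ((r *\<^sub>R ?c w)$1 + (r *\<^sub>R ?c w)$4) * ((r *\<^sub>R ?c w)$1 - (r *\<^sub>R ?c w)$4)"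
        unfolding e by (simp add: power_mult_distrib distrib_left power2_eq_square mult_ac)
    qed
  qed
  then show ?thesis using congruent_to_piece_ofI[OF fr r] by blast
qed

lemma parabolic_case:
  assumes fr: "lorentz_frame T E2 E3 E4" and P: "T + E4 \<in> P" "E3 \<in> P"
  shows "\<exists>c. congruent_to_piece_of (X ` D) (parabolic_catenoid c)"
proof -
  note F = fr[unfolded lorentz_frame_def]
  let ?c = "\<lambda>w. frame_coords T E2 E3 E4 (X w)"
  define N where "N = T + E4"
  have N: "lorentz N N = 0" "lorentz N E3 = 0"
    using F by (simp_all add: N_def lorentz_simps lorentz_commute[of T E4] lorentz_commute[of T E3] lorentz_commute[of E4 E3])
  have "lorentz N T = - 1" using F by (simp add: N_def lorentz_simps)
  then have nz: "N \<noteq> 0" by (auto simp: lorentz_simps)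
  have NP: "N \<in> P" using P by (simp add: N_def)
  have c: "lorentz (X w) N = - (?c w$1 - ?c w$4)" for w by (simp add: N_def lorentz_simps)
  have neg: "lorentz (X w) N < 0" if w: "w \<in> D" for w
    using null_axis_direction[OF NP N(1) nz w] frame_coords_null(3)[OF fr w] unfolding c by linarith
  obtain l k where lk: "\<And>w. w \<in> D \<Longrightarrow>
      ln (- lorentz (X w) N) = l * (lorentz (X w) E3 / lorentz (X w) N) + k"
    using degenerate_axis_relation[OF N(1) _ N(2) neg axis_jacobian[OF _ NP P(2)]] F by blast
  \<comment> \<open>Scaling leaves the quotient of the two coordinates alone, so the shift of the
    single logarithm absorbs \<open>k\<close>. The parameter becomes \<open>- l\<close> because the
    pairing with \<open>N\<close> is minus the lower right entry.\<close>
  define r where "r = exp (- k)"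
  have r: "r > 0" "ln r = - k" by (simp_all add: r_def)
  have "herm (r *\<^sub>R ?c w) \<in> range (parabolic_catenoid (- l))" if w: "w \<in> D" for w
  proof (rule herm_in_parabolic_catenoid)
    define A where "A = ?c w$1 + ?c w$4"
    define B where "B = ?c w$1 - ?c w$4"
    have B: "B > 0" using neg[OF w] unfolding c B_def by simp
    have e: "(r *\<^sub>R ?c w)$1 + (r *\<^sub>R ?c w)$4 = r * A" "(r *\<^sub>R ?c w)$1 - (r *\<^sub>R ?c w)$4 = r * B"
      by (simp_all add: A_def B_def algebra_simps)
    show "(r *\<^sub>R ?c w)$1 - (r *\<^sub>R ?c w)$4 > 0" unfolding e using B r by simp
    have "r\<^sup>2 * ((?c w$2)\<^sup>2 + (?c w$3)\<^sup>2) = r\<^sup>2 * (A * B)"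
      unfolding A_def B_def frame_coords_null(1)[OF fr w] ..
    then show "((r *\<^sub>R ?c w)$2)\<^sup>2 + ((r *\<^sub>R ?c w)$3)\<^sup>2
        = ((r *\<^sub>R ?c w)$1 + (r *\<^sub>R ?c w)$4) * ((r *\<^sub>R ?c w)$1 - (r *\<^sub>R ?c w)$4)"
      unfolding e by (simp add: power_mult_distrib distrib_left power2_eq_square mult_ac)
    have "ln B = l * (?c w$3 / (- B)) + k"
      using lk[OF w] unfolding c B_def minus_minus frame_coords_nth(3) .
    moreover have "(r *\<^sub>R ?c w)$3 / (r * B) = ?c w$3 / B" using r by simp
    ultimately show "ln ((r *\<^sub>R ?c w)$1 - (r *\<^sub>R ?c w)$4)
        = - l * ((r *\<^sub>R ?c w)$3 / ((r *\<^sub>R ?c w)$1 - (r *\<^sub>R ?c w)$4))"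
      unfolding e using B r by (simp add: ln_mult)
  qed
  then show ?thesis using congruent_to_piece_ofI[OF fr r(1)] by blast
qed

end

lemma rotational_zmc_surface_is_catenoid:
  assumes "rotational_surface S" "zmc_surface S"
  shows "(\<exists>a. congruent_to_piece_of S (elliptic_catenoid a)) \<or>
         (\<exists>b. congruent_to_piece_of S (hyperbolic_catenoid b)) \<or>
         (\<exists>c. congruent_to_piece_of S (parabolic_catenoid c))"
proof -
  obtain P P3 I \<gamma> where P: "subspace P" "dim P = 2" "regular_curve I \<gamma>" "\<gamma> ` I \<inter> P = {}"
    "S = {T (\<gamma> t) |T t. T \<in> rotation_group P \<and> t \<in> I}"
    using assms(1) unfolding rotational_surface_def by blast
  obtain D X \<phi> where X: "open D" "connected D" "D \<noteq> {}" "conformal_spacelike_immersion D X \<phi>"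
    "\<forall>w\<in>D. mean_curvature X \<phi> w = 0" "X ` D = S"
    using assms(2) unfolding zmc_surface_def by blast
  interpret rotational_zmc D X \<phi> P I \<gamma>
    by unfold_locales (use P X in auto)
  show ?thesis
    using P(1,2)
  proof (cases rule: plane_frame_cases)
    case lorentzian
    then show ?thesis using elliptic_case X(6) by blast
  next
    case riemannian
    then show ?thesis using hyperbolic_case X(6) by blast
  next
    case degenerate
    then show ?thesis using parabolic_case X(6) by blast
  qed
qed

section \<open>Weierstrass data of the catenoids\<close>

lemma mat2_mult:
  "mat2 a b c d ** mat2 a' b' c' d' = mat2 (a*a' + b*c') (a*b' + b*d') (c*a' + d*c') (c*b' + d*d')"
  by (simp add: vec_eq_iff forall_2 matrix_matrix_mult_def sum_2)

lemma ctranspose_mat2: "ctranspose (mat2 a b c d) = mat2 (cnj a) (cnj c) (cnj b) (cnj d)"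
  by (simp add: vec_eq_iff forall_2 ctranspose_def)

text \<open>The surface sees only the first column \<open>(p, q)\<close> of the frame. The second
  column merely has to solve the same linear system with determinant 1.\<close>

lemma has_weierstrass_formI:
  assumes der: "\<And>w. (p has_field_derivative p' w) (at w)" "\<And>w. (p2 has_field_derivative p2' w) (at w)"
      "\<And>w. (q has_field_derivative q' w) (at w)" "\<And>w. (q2 has_field_derivative q2' w) (at w)"
    and det: "\<And>w. p w * q2 w - p2 w * q w = 1"
    and M: "\<And>w. M w = mat2 (p w * cnj (p w)) (p w * cnj (q w)) (q w * cnj (p w)) (q w * cnj (q w))"
    and A: "\<And>w. mat2 (p' w) (p2' w) (q' w) (q2' w) = A w ** mat2 (p w) (p2 w) (q w) (q2 w)"
  shows "has_weierstrass_form UNIV M A"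
  unfolding has_weierstrass_form_def
proof (rule exI[of _ "\<lambda>w. mat2 (p w) (p2 w) (q w) (q2 w)"],
    rule exI[of _ "\<lambda>w. mat2 (p' w) (p2' w) (q' w) (q2' w)"], intro ballI conjI)
  fix w
  let ?F = "mat2 (p w) (p2 w) (q w) (q2 w)"
  show d: "det ?F = 1" using det by (simp add: det_2)
  show "M w = ?F ** mat2 1 0 0 0 ** ctranspose ?F"
    by (simp add: M mat2_mult ctranspose_mat2)
  show "\<forall>i j. ((\<lambda>\<zeta>. mat2 (p \<zeta>) (p2 \<zeta>) (q \<zeta>) (q2 \<zeta>) $ i $ j) has_field_derivative
      mat2 (p' w) (p2' w) (q' w) (q2' w) $ i $ j) (at w)"
    using der by (simp add: forall_2)
  have "invertible ?F" using d by (simp add: invertible_det_nz)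
  then have "?F ** matrix_inv ?F = mat 1"
    unfolding invertible_def matrix_inv_def by (rule someI2_ex) simp
  then show "mat2 (p' w) (p2' w) (q' w) (q2' w) ** matrix_inv ?F = A w"
    by (simp add: A matrix_mul_assoc[symmetric])
qed

text \<open>A fundamental solution for complex parameter \<open>a\<close>; the first column is
  \<open>(exp (- \<i> (a - 2) \<zeta> / 2), exp (- \<i> (a + 2) \<zeta> / 2))\<close>.  For \<open>a = 0\<close> the two exponents of the
  second column coincide and it acquires a factor linear in \<open>\<zeta>\<close>.\<close>

lemma exponential_frame:
  fixes a :: complex
  obtains p2 q2 :: "complex \<Rightarrow> complex" where
    "\<And>z. (p2 has_field_derivative (- \<i> * (a - 2) * (a + 2) / 8 * p2 z + \<i> * (a - 2)\<^sup>2 / 8 * exp (2 * \<i> * z) * q2 z)) (at z)"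
    "\<And>z. (q2 has_field_derivative (- \<i> * (a + 2)\<^sup>2 / 8 * exp (- 2 * \<i> * z) * p2 z + \<i> * (a - 2) * (a + 2) / 8 * q2 z)) (at z)"
    "\<And>z. exp (- \<i> * (a - 2) * z / 2) * q2 z - p2 z * exp (- \<i> * (a + 2) * z / 2) = 1"
proof (cases "a = 0")
  case True
  \<comment> \<open>This is \<open>\<i> * z / 2\<close> times the first column plus
    \<open>(0, exp (- \<i> * z))\<close>; the multiple of the first column does not affect the
    determinant.\<close>
  let ?p = "\<lambda>z. \<i> * z / 2 * exp (\<i> * z)" and ?q = "\<lambda>z. (1 + \<i> * z / 2) * exp (- \<i> * z)"
  have e: "exp (2 * \<i> * z) * exp (- \<i> * z) = exp (\<i> * z)" "exp (- 2 * \<i> * z) * exp (\<i> * z) = exp (- \<i> * z)"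
     "exp (\<i> * z) * exp (- \<i> * z) = 1" for z
    by (simp_all add: exp_add[symmetric] algebra_simps)
  have c: "- \<i> * (a - 2) * (a + 2) / 8 = \<i> / 2" "\<i> * (a - 2)\<^sup>2 / 8 = \<i> / 2"
    "- \<i> * (a + 2)\<^sup>2 / 8 = - \<i> / 2" "\<i> * (a - 2) * (a + 2) / 8 = - \<i> / 2"
    using True by simp_all
  show ?thesis
  proof (rule that[of ?p ?q])
    fix z
    have "\<i> / 2 * ?p z + \<i> / 2 * exp (2 * \<i> * z) * ?q z = \<i> / 2 * exp (\<i> * z) + \<i> * z / 2 * (\<i> * exp (\<i> * z))"
      unfolding e(1)[of z, symmetric] by (simp add: algebra_simps add_divide_distrib diff_divide_distrib)
    moreover have "(?p has_field_derivative (\<i> / 2 * exp (\<i> * z) + \<i> * z / 2 * (\<i> * exp (\<i> * z)))) (at z)"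
      by (auto intro!: derivative_eq_intros simp: field_simps)
    ultimately show "(?p has_field_derivative (- \<i> * (a - 2) * (a + 2) / 8 * ?p z + \<i> * (a - 2)\<^sup>2 / 8 * exp (2 * \<i> * z) * ?q z)) (at z)"
      unfolding c by simp
    have "- \<i> / 2 * exp (- 2 * \<i> * z) * ?p z + - \<i> / 2 * ?q z = \<i> / 2 * exp (- \<i> * z) + (1 + \<i> * z / 2) * (- \<i> * exp (- \<i> * z))"
      unfolding e(2)[of z, symmetric] by (simp add: algebra_simps add_divide_distrib diff_divide_distrib)
    moreover have "(?q has_field_derivative (\<i> / 2 * exp (- \<i> * z) + (1 + \<i> * z / 2) * (- \<i> * exp (- \<i> * z)))) (at z)"
      by (auto intro!: derivative_eq_intros simp: field_simps)
    ultimately show "(?q has_field_derivative (- \<i> * (a + 2)\<^sup>2 / 8 * exp (- 2 * \<i> * z) * ?p z + \<i> * (a - 2) * (a + 2) / 8 * ?q z)) (at z)"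
      unfolding c by simp
    have "exp (\<i> * z) * ?q z - ?p z * exp (- \<i> * z) = exp (\<i> * z) * exp (- \<i> * z)"
      by (simp only: algebra_simps) simp
    then show "exp (- \<i> * (a - 2) * z / 2) * ?q z - ?p z * exp (- \<i> * (a + 2) * z / 2) = 1"
      unfolding e using True by simp
  qed
next
  case False
  \<comment> \<open>With the opposite exponents, the system fixes the ratio of the coefficients as
    that of \<open>(a - 2)\<^sup>2\<close> to \<open>(a + 2)\<^sup>2\<close>. The determinant
    requires \<open>y - x = 1\<close>, and the two squares differ by \<open>8 * a\<close>.\<close>
  define x where "x = (a - 2)\<^sup>2 / (8 * a)"
  define y where "y = (a + 2)\<^sup>2 / (8 * a)"
  let ?s = "\<lambda>z. exp (\<i> * (a + 2) * z / 2)" and ?t = "\<lambda>z. exp (\<i> * (a - 2) * z / 2)"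
  have e: "exp (2 * \<i> * z) * ?t z = ?s z" "exp (- 2 * \<i> * z) * ?s z = ?t z"
     "exp (- \<i> * (a - 2) * z / 2) * ?t z = 1" "exp (- \<i> * (a + 2) * z / 2) * ?s z = 1" for z
    by (simp_all add: exp_add[symmetric] field_simps)
  have xy: "y - x = 1" "- \<i> * (a - 2) * (a + 2) / 8 * x + \<i> * (a - 2)\<^sup>2 / 8 * y = \<i> * (a + 2) / 2 * x"
    "- \<i> * (a + 2)\<^sup>2 / 8 * x + \<i> * (a - 2) * (a + 2) / 8 * y = \<i> * (a - 2) / 2 * y"
    using False by (simp_all add: x_def y_def field_simps power2_eq_square)
  show ?thesis
  proof (rule that[of "\<lambda>z. x * ?s z" "\<lambda>z. y * ?t z"])
    fix z
    have "- \<i> * (a - 2) * (a + 2) / 8 * (x * ?s z) + \<i> * (a - 2)\<^sup>2 / 8 * exp (2 * \<i> * z) * (y * ?t z)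
       = (- \<i> * (a - 2) * (a + 2) / 8 * x + \<i> * (a - 2)\<^sup>2 / 8 * y) * ?s z"
      unfolding e(1)[symmetric] by (simp add: algebra_simps)
    note eq = this[unfolded xy(2)]
    have "((\<lambda>z. x * ?s z) has_field_derivative \<i> * (a + 2) / 2 * x * ?s z) (at z)"
      by (auto intro!: derivative_eq_intros simp: field_simps)
    then show "((\<lambda>z. x * ?s z) has_field_derivative (- \<i> * (a - 2) * (a + 2) / 8 * (x * ?s z) + \<i> * (a - 2)\<^sup>2 / 8 * exp (2 * \<i> * z) * (y * ?t z))) (at z)"
      unfolding eq .
    have "- \<i> * (a + 2)\<^sup>2 / 8 * exp (- 2 * \<i> * z) * (x * ?s z) + \<i> * (a - 2) * (a + 2) / 8 * (y * ?t z)
       = (- \<i> * (a + 2)\<^sup>2 / 8 * x + \<i> * (a - 2) * (a + 2) / 8 * y) * ?t z"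
      unfolding e(2)[symmetric] by (simp add: algebra_simps)
    note eq = this[unfolded xy(3)]
    have "((\<lambda>z. y * ?t z) has_field_derivative \<i> * (a - 2) / 2 * y * ?t z) (at z)"
      by (auto intro!: derivative_eq_intros simp: field_simps)
    then show "((\<lambda>z. y * ?t z) has_field_derivative (- \<i> * (a + 2)\<^sup>2 / 8 * exp (- 2 * \<i> * z) * (x * ?s z) + \<i> * (a - 2) * (a + 2) / 8 * (y * ?t z))) (at z)"
      unfolding eq .
    show "exp (- \<i> * (a - 2) * z / 2) * (y * ?t z) - x * ?s z * exp (- \<i> * (a + 2) * z / 2) = 1"
      using e(3,4)[of z] xy(1) by (simp add: mult.left_commute mult.commute mult.assoc)
  qed
qed


lemma has_weierstrass_dataI:
  assumes "G holomorphic_on UNIV" "h holomorphic_on UNIV"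
    and "has_weierstrass_form UNIV M (\<lambda>w. weierstrass_matrix (G w) (h w))"
  shows "has_weierstrass_data UNIV M G h"
  unfolding has_weierstrass_data_def
proof (intro conjI)
  have "G analytic_on UNIV" using assms(1) by (simp add: analytic_on_open)
  then show "G meromorphic_on UNIV" by (rule analytic_on_imp_meromorphic_on)
  show "h holomorphic_on UNIV" by fact
  have "\<forall>i j. (\<lambda>w. weierstrass_matrix (G w) (h w) $ i $ j) holomorphic_on UNIV"
    using assms(1,2) by (auto simp: forall_2 weierstrass_matrix_def intro!: holomorphic_intros)
  with assms(3) show "\<exists>A. (\<forall>i j. (\<lambda>w. A w $ i $ j) holomorphic_on UNIV) \<and>
      (\<forall>w\<in>UNIV. G analytic_on {w} \<longrightarrow> A w = weierstrass_matrix (G w) (h w)) \<and>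
      has_weierstrass_form UNIV M A"
    by (intro exI[of _ "\<lambda>w. weierstrass_matrix (G w) (h w)"]) simp
qed

text \<open>The first column consists of the holomorphic exponentials whose squared moduli are the
  diagonal entries. Working with the matrix polynomial in \<open>a\<close> includes the parameter
  where \<open>G_E\<close> is undefined.\<close>

lemma elliptic_weierstrass_form: "has_weierstrass_form UNIV (elliptic_catenoid a) (weierstrass_E a)"
proof -
  let ?a = "complex_of_real a"
  obtain p2 q2 :: "complex \<Rightarrow> complex" where
    d: "\<And>z. (p2 has_field_derivative (- \<i> * (?a - 2) * (?a + 2) / 8 * p2 z + \<i> * (?a - 2)\<^sup>2 / 8 * exp (2 * \<i> * z) * q2 z)) (at z)"
    "\<And>z. (q2 has_field_derivative (- \<i> * (?a + 2)\<^sup>2 / 8 * exp (- 2 * \<i> * z) * p2 z + \<i> * (?a - 2) * (?a + 2) / 8 * q2 z)) (at z)"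
    "\<And>z. exp (- \<i> * (?a - 2) * z / 2) * q2 z - p2 z * exp (- \<i> * (?a + 2) * z / 2) = 1"
    by (rule exponential_frame[of ?a]) (rule that; blast)
  let ?p = "\<lambda>z. exp (- \<i> * (?a - 2) * z / 2)" and ?q = "\<lambda>z. exp (- \<i> * (?a + 2) * z / 2)"
  have e: "exp (2 * \<i> * z) * ?q z = ?p z" "exp (- 2 * \<i> * z) * ?p z = ?q z" for z
    by (simp_all add: exp_add[symmetric] field_simps)
  show ?thesis
  proof (rule has_weierstrass_formI[of ?p _ p2 _ ?q _ q2, OF _ d(1) _ d(2) d(3)])
    show "(?p has_field_derivative - \<i> * (?a - 2) / 2 * ?p w) (at w)"
      "(?q has_field_derivative - \<i> * (?a + 2) / 2 * ?q w) (at w)" for w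
      by (auto intro!: derivative_eq_intros simp: field_simps)
    show "elliptic_catenoid a w = mat2 (?p w * cnj (?p w)) (?p w * cnj (?q w)) (?q w * cnj (?p w)) (?q w * cnj (?q w))" for w
      unfolding elliptic_catenoid_def Let_def mat2_eq_iff exp_cnj exp_add[symmetric]
      by (intro conjI arg_cong[where f = exp]) (simp_all add: complex_eq_iff field_simps)
    fix w
    have 1: "- \<i> * (?a - 2) / 2 * ?p w
      = - \<i> * (?a - 2) * (?a + 2) / 8 * ?p w + \<i> * (?a - 2)\<^sup>2 / 8 * exp (2 * \<i> * w) * ?q w"
      unfolding mult.assoc[of _ "exp (2 * \<i> * w)"] e(1)
      by (simp only: distrib_right[symmetric]) (simp add: field_simps power2_eq_square)
    have 2: "- \<i> * (?a + 2) / 2 * ?q w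
      = - \<i> * (?a + 2)\<^sup>2 / 8 * exp (- 2 * \<i> * w) * ?p w + \<i> * (?a - 2) * (?a + 2) / 8 * ?q w"
      unfolding mult.assoc[of _ "exp (- 2 * \<i> * w)"] e(2)
      by (simp only: distrib_right[symmetric]) (simp add: field_simps power2_eq_square)
    show "mat2 (- \<i> * (?a - 2) / 2 * ?p w)
        (- \<i> * (?a - 2) * (?a + 2) / 8 * p2 w + \<i> * (?a - 2)\<^sup>2 / 8 * exp (2 * \<i> * w) * q2 w)
        (- \<i> * (?a + 2) / 2 * ?q w)
        (- \<i> * (?a + 2)\<^sup>2 / 8 * exp (- 2 * \<i> * w) * p2 w + \<i> * (?a - 2) * (?a + 2) / 8 * q2 w)
      = weierstrass_E a w ** mat2 (?p w) (p2 w) (?q w) (q2 w)"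
      unfolding weierstrass_E_def mat2_mult 1 2 ..
  qed
qed

text \<open>The holomorphic system is the elliptic one for the imaginary parameter
  \<open>\<i> * b\<close> in the rotated variable \<open>- \<i> * w\<close>, which is why
  \<open>exponential_frame\<close> allows complex parameters. Only the conjugates in the surface
  differ.\<close>

lemma hyperbolic_weierstrass_form:
  "has_weierstrass_form UNIV (hyperbolic_catenoid b) (\<lambda>w. weierstrass_matrix (G_H b w) (\<Omega>_H b w))"
proof -
  define a where "a = \<i> * complex_of_real b"
  obtain p2 q2 :: "complex \<Rightarrow> complex" where
    d: "\<And>z. (p2 has_field_derivative (- \<i> * (a - 2) * (a + 2) / 8 * p2 z + \<i> * (a - 2)\<^sup>2 / 8 * exp (2 * \<i> * z) * q2 z)) (at z)"
    "\<And>z. (q2 has_field_derivative (- \<i> * (a + 2)\<^sup>2 / 8 * exp (- 2 * \<i> * z) * p2 z + \<i> * (a - 2) * (a + 2) / 8 * q2 z)) (at z)"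
    "\<And>z. exp (- \<i> * (a - 2) * z / 2) * q2 z - p2 z * exp (- \<i> * (a + 2) * z / 2) = 1"
    by (rule exponential_frame[of a]) (rule that; blast)
  let ?p = "\<lambda>w. exp (- (a - 2) * w / 2)" and ?q = "\<lambda>w. exp (- (a + 2) * w / 2)"
  let ?p2 = "\<lambda>w. p2 (- \<i> * w)" and ?q2 = "\<lambda>w. q2 (- \<i> * w)"
  have e: "exp (2 * w) * ?q w = ?p w" "exp (- 2 * w) * ?p w = ?q w" for w
    by (simp_all add: exp_add[symmetric] field_simps)
  have i: "exp (2 * \<i> * (- \<i> * w)) = exp (2 * w)" "exp (- 2 * \<i> * (- \<i> * w)) = exp (- 2 * w)"
    "exp (- \<i> * (a - 2) * (- \<i> * w) / 2) = ?p w" "exp (- \<i> * (a + 2) * (- \<i> * w) / 2) = ?q w" for w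
    by (rule arg_cong[where f = exp], simp add: field_simps)+
  have lin: "((\<lambda>w. - \<i> * w) has_field_derivative - \<i>) (at w)" for w
    by (auto intro!: derivative_eq_intros)
  have nz: "complex_of_real b - 2 * \<i> \<noteq> 0" by (simp add: complex_eq_iff)
  have W: "weierstrass_matrix (G_H b w) (\<Omega>_H b w) =
      mat2 (- (a - 2) * (a + 2) / 8) ((a - 2)\<^sup>2 / 8 * exp (2 * w))
           (- (a + 2)\<^sup>2 / 8 * exp (- 2 * w)) ((a - 2) * (a + 2) / 8)" for w
  proof -
    have a2: "a - 2 = \<i> * (of_real b + 2 * \<i>)" "a + 2 = \<i> * (of_real b - 2 * \<i>)"
      by (simp_all add: a_def algebra_simps)
    have e': "exp (- 2 * w) = inverse (exp (2 * w))" by (simp add: exp_minus)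
    show ?thesis
      unfolding weierstrass_matrix_def G_H_def \<Omega>_H_def mat2_eq_iff a2 e'
      using nz by (simp add: divide_simps power2_eq_square) (simp add: algebra_simps)
  qed
  show ?thesis
  proof (rule has_weierstrass_formI[of ?p _ ?p2 _ ?q _ ?q2, OF _ DERIV_chain2[OF d(1) lin] _ DERIV_chain2[OF d(2) lin]])
    show "(?p has_field_derivative - (a - 2) / 2 * ?p w) (at w)"
      "(?q has_field_derivative - (a + 2) / 2 * ?q w) (at w)" for w
      by (auto intro!: derivative_eq_intros simp: field_simps)
    show "?p w * ?q2 w - ?p2 w * ?q w = 1" for w
      using d(3)[of "- \<i> * w"] unfolding i .
    show "hyperbolic_catenoid b w = mat2 (?p w * cnj (?p w)) (?p w * cnj (?q w)) (?q w * cnj (?p w)) (?q w * cnj (?q w))" for w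
      unfolding hyperbolic_catenoid_def Let_def mat2_eq_iff exp_cnj exp_add[symmetric] a_def
      by (intro conjI arg_cong[where f = exp]) (simp_all add: complex_eq_iff field_simps)
    fix w
    have 1: "- (a - 2) / 2 * ?p w = - (a - 2) * (a + 2) / 8 * ?p w + (a - 2)\<^sup>2 / 8 * exp (2 * w) * ?q w"
      unfolding mult.assoc[of _ "exp (2 * w)"] e(1)
      by (simp only: distrib_right[symmetric]) (simp add: field_simps power2_eq_square)
    have 2: "- (a + 2) / 2 * ?q w = - (a + 2)\<^sup>2 / 8 * exp (- 2 * w) * ?p w + (a - 2) * (a + 2) / 8 * ?q w"
      unfolding mult.assoc[of _ "exp (- 2 * w)"] e(2)
      by (simp only: distrib_right[symmetric]) (simp add: field_simps power2_eq_square)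
    show "mat2 (- (a - 2) / 2 * ?p w)
        ((- \<i> * (a - 2) * (a + 2) / 8 * ?p2 w + \<i> * (a - 2)\<^sup>2 / 8 * exp (2 * \<i> * (- \<i> * w)) * ?q2 w) * - \<i>)
        (- (a + 2) / 2 * ?q w)
        ((- \<i> * (a + 2)\<^sup>2 / 8 * exp (- 2 * \<i> * (- \<i> * w)) * ?p2 w + \<i> * (a - 2) * (a + 2) / 8 * ?q2 w) * - \<i>)
      = weierstrass_matrix (G_H b w) (\<Omega>_H b w) ** mat2 (?p w) (?p2 w) (?q w) (?q2 w)"
      unfolding W mat2_mult mat2_eq_iff i
      by (intro conjI 1 2) (simp_all add: field_simps)
  qed
qed

lemma parabolic_weierstrass_form: "has_weierstrass_form UNIV (parabolic_catenoid c) (weierstrass_P c)"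
proof -
  let ?c = "complex_of_real c"
  let ?q = "\<lambda>w. exp (- \<i> * ?c * w / 2)" and ?r = "\<lambda>w. exp (\<i> * ?c * w / 2)"
  \<comment> \<open>The matrix of the surface is \<open>exp (c * v)\<close> times the square of the
    column \<open>(w, 1)\<close>, and \<open>?q\<close> is a holomorphic function of squared modulus
    \<open>exp (c * v)\<close>. The second column uses the opposite exponent; its constants are
    fixed by the system and determinant 1, also for \<open>c = 0\<close>.\<close>
  let ?p = "\<lambda>w. w * ?q w" and ?q2 = "\<lambda>w. \<i> * ?c / 4 * ?r w" and ?p2 = "\<lambda>w. (\<i> * ?c / 4 * w - 1) * ?r w"
  have e: "?q w * ?r w = 1" for w by (simp add: exp_add[symmetric])
  show ?thesis
  proof (rule has_weierstrass_formI[of ?p _ ?p2 _ ?q _ ?q2])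
    show "(?p has_field_derivative (1 - \<i> * ?c * w / 2) * ?q w) (at w)"
      "(?q has_field_derivative - \<i> * ?c / 2 * ?q w) (at w)"
      "(?p2 has_field_derivative (- \<i> * ?c / 4 - ?c\<^sup>2 * w / 8) * ?r w) (at w)"
      "(?q2 has_field_derivative - ?c\<^sup>2 / 8 * ?r w) (at w)" for w
      by (auto intro!: derivative_eq_intros simp: field_simps power2_eq_square)
    show "?p w * ?q2 w - ?p2 w * ?q w = 1" for w
    proof -
      have "?p w * ?q2 w - ?p2 w * ?q w = ?q w * ?r w" by (simp only: algebra_simps) simp
      with e show ?thesis by simp
    qed
    show "parabolic_catenoid c w = mat2 (?p w * cnj (?p w)) (?p w * cnj (?q w)) (?q w * cnj (?p w)) (?q w * cnj (?q w))" for w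
    proof -
      have 1: "exp (?c * of_real (Im w)) = ?q w * cnj (?q w)"
        unfolding exp_cnj exp_add[symmetric]
        by (rule arg_cong[where f = exp]) (simp add: complex_eq_iff field_simps)
      have 2: "of_real (Re w) + \<i> * of_real (Im w) = w" "of_real (Re w) - \<i> * of_real (Im w) = cnj w"
         "(of_real (Re w))\<^sup>2 + (of_real (Im w))\<^sup>2 = w * cnj w"
        by (simp_all add: complex_eq_iff power2_eq_square)
      show ?thesis
        unfolding parabolic_catenoid_def Let_def mat2_eq_iff 2 1 complex_cnj_mult by (simp only: ac_simps)
    qed
    fix w
    show "mat2 ((1 - \<i> * ?c * w / 2) * ?q w) ((- \<i> * ?c / 4 - ?c\<^sup>2 * w / 8) * ?r w)
        (- \<i> * ?c / 2 * ?q w) (- ?c\<^sup>2 / 8 * ?r w)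
      = weierstrass_P c w ** mat2 (?p w) (?p2 w) (?q w) (?q2 w)"
      unfolding weierstrass_P_def mat2_mult mat2_eq_iff
      by (intro conjI) (simp_all add: field_simps power2_eq_square)
  qed
qed

lemma catenoids_weierstrass_data:
  shows "a \<noteq> - 2 \<Longrightarrow> has_weierstrass_data UNIV (elliptic_catenoid a) (G_E a) (\<Omega>_E a)"
    and "has_weierstrass_data UNIV (hyperbolic_catenoid b) (G_H b) (\<Omega>_H b)"
    and "c \<noteq> 0 \<Longrightarrow> has_weierstrass_data UNIV (parabolic_catenoid c) (G_P c) (\<Omega>_P c)"
proof -
  show "has_weierstrass_data UNIV (elliptic_catenoid a) (G_E a) (\<Omega>_E a)" if "a \<noteq> - 2"
  proof (rule has_weierstrass_dataI)
    have "complex_of_real a + 2 \<noteq> 0" using that by (simp add: complex_eq_iff)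
    then show "G_E a holomorphic_on UNIV" "\<Omega>_E a holomorphic_on UNIV"
      unfolding G_E_def[abs_def] \<Omega>_E_def[abs_def] by (auto intro!: holomorphic_intros)
    have "weierstrass_E a = (\<lambda>w. weierstrass_matrix (G_E a w) (\<Omega>_E a w))"
      using weierstrass_E_eq[OF that] by blast
    then show "has_weierstrass_form UNIV (elliptic_catenoid a) (\<lambda>w. weierstrass_matrix (G_E a w) (\<Omega>_E a w))"
      using elliptic_weierstrass_form[of a] by simp
  qed
  show "has_weierstrass_data UNIV (hyperbolic_catenoid b) (G_H b) (\<Omega>_H b)"
  proof (rule has_weierstrass_dataI[OF _ _ hyperbolic_weierstrass_form])
    have "complex_of_real b - 2 * \<i> \<noteq> 0" by (simp add: complex_eq_iff)
    then show "G_H b holomorphic_on UNIV" "\<Omega>_H b holomorphic_on UNIV"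
      unfolding G_H_def[abs_def] \<Omega>_H_def[abs_def] by (auto intro!: holomorphic_intros)
  qed
  show "has_weierstrass_data UNIV (parabolic_catenoid c) (G_P c) (\<Omega>_P c)" if "c \<noteq> 0"
  proof (rule has_weierstrass_dataI)
    show "G_P c holomorphic_on UNIV" "\<Omega>_P c holomorphic_on UNIV"
      unfolding G_P_def[abs_def] \<Omega>_P_def[abs_def] using that by (auto intro!: holomorphic_intros)
    have "weierstrass_P c = (\<lambda>w. weierstrass_matrix (G_P c w) (\<Omega>_P c w))"
      using weierstrass_P_eq[OF that] by blast
    then show "has_weierstrass_form UNIV (parabolic_catenoid c) (\<lambda>w. weierstrass_matrix (G_P c w) (\<Omega>_P c w))"
      using parabolic_weierstrass_form[of c] by simp
  qed
qed

theorem theorem4p4: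
  fixes S :: "L4 set"
  assumes "rotational_surface S"
    and "zmc_surface S"
  shows "((\<exists>a. congruent_to_piece_of S (elliptic_catenoid a)) \<or>
          (\<exists>b. congruent_to_piece_of S (hyperbolic_catenoid b)) \<or>
          (\<exists>c. congruent_to_piece_of S (parabolic_catenoid c))) \<and>
         (\<forall>a. a \<noteq> - 2 \<longrightarrow> has_weierstrass_data UNIV (elliptic_catenoid a) (G_E a) (\<Omega>_E a)) \<and>
         has_weierstrass_form UNIV (elliptic_catenoid (- 2)) (weierstrass_E (- 2)) \<and>
         (\<forall>b. has_weierstrass_data UNIV (hyperbolic_catenoid b) (G_H b) (\<Omega>_H b)) \<and>
         (\<forall>c. c \<noteq> 0 \<longrightarrow> has_weierstrass_data UNIV (parabolic_catenoid c) (G_P c) (\<Omega>_P c)) \<and>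
         has_weierstrass_form UNIV (parabolic_catenoid 0) (weierstrass_P 0)"
  using rotational_zmc_surface_is_catenoid[OF assms] catenoids_weierstrass_data
    elliptic_weierstrass_form[of "- 2"] parabolic_weierstrass_form[of 0]
  by blast

end
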